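(* Let $m=m(n)$ and $d=d(n)$ be positive integers with $d\le m$, and let $H=H(n)\sim\mathcal{H}(n,m,d)$. Suppose that, as $n\to\infty$, $dn/m\to\infty$, $d\to\infty$, and $d/m$ is bounded away from $1$ (i.e. $d/m\le 1-\varepsilon_0$ for some constant $\varepsilon_0>0$). (i) If $m=O(n)$, then with high probability $$\operatorname{disc}(H)=\Omega\left(\max\left\{2^{-n/m}\sqrt{\frac{dn}{m}},\,1\right\}\right).$$ (ii) If $m\gg n$, then with high probability $$\operatorname{disc}(H)=\Omega\left(\sqrt{\frac{dn}{m}\log\gamma}\right),\qquad\text{where }\gamma:=\min\{m/n,\,dn/m\}.$$ Here "with high probability $\operatorname{disc}(H)=\Omega(g(n))$" means that there is a constant $\kappa>0$ (not depending on $n$) such that $\mathbb{P}[\operatorname{disc}(H)\ge\kappa\, g(n)]\to1$ as $n\to\infty$.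
   Context: A hypergraph $H=(V,E)$ consists of a vertex set $V=\{v_1,\dots,v_n\}$ and a multiset $E=\{e_1,\dots,e_m\}$ of subsets of $V$ (edges; repetitions allowed). A colouring is a function $\psi:V\to\{-1,1\}$; for an edge $e$ put $\psi(e)=\sum_{v\in e}\psi(v)$, and $\operatorname{disc}(\psi)=\max_{e\in E}|\psi(e)|$. The discrepancy of $H$ is $\operatorname{disc}(H)=\min_\psi\operatorname{disc}(\psi)$, the minimum being over all colourings. Edge-dependent model $\mathcal{H}(n,m,d)$: for each vertex $v\in\{v_1,\dots,v_n\}$, independently draw a uniformly random subset $I_v\subseteq\{1,\dots,m\}$ with $|I_v|=d$, and define the edges by $e_i=\{u\in V: i\in I_u\}$ for $1\le i\le m$. All asymptotics are as $n\to\infty$; $m\gg n$ means $n/m\to0$; $\log$ is the natural logarithm. An event holds with high probability if its probability tends to $1$ as $n\to\infty$. *)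

theory Defs
  imports "HOL-Probability.Probability"
begin

text \<open>The edges form a multiset, so that an edge may be repeated.\<close>

record 'v hypergraph =
  verts :: "'v set"
  edges :: "'v set multiset"

definition colourings :: "'v hypergraph \<Rightarrow> ('v \<Rightarrow> int) set" where
  "colourings H = verts H \<rightarrow>\<^sub>E {-1, 1}"

definition edge_sum :: "('v \<Rightarrow> int) \<Rightarrow> 'v set \<Rightarrow> int" where
  "edge_sum \<psi> e = (\<Sum>v\<in>e. \<psi> v)"

text \<open>The two definitions below are meant for a finite vertex set, edges contained in it,
  and at least one edge: \<open>Max\<close> and \<open>Min\<close> are unspecified on empty and on infinite sets.\<close>

definition colouring_disc :: "'v hypergraph \<Rightarrow> ('v \<Rightarrow> int) \<Rightarrow> int" where
  "colouring_disc H \<psi> = Max ((\<lambda>e. \<bar>edge_sum \<psi> e\<bar>) ` set_mset (edges H))"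

definition disc :: "'v hypergraph \<Rightarrow> int" where
  "disc H = Min (colouring_disc H ` colourings H)"

definition incidence_hypergraph :: "nat \<Rightarrow> nat \<Rightarrow> (nat \<Rightarrow> nat set) \<Rightarrow> nat hypergraph" where
  "incidence_hypergraph n m I =
     \<lparr>verts = {1..n},
      edges = image_mset (\<lambda>i. {u \<in> {1..n}. i \<in> I u}) (mset_set {1..m})\<rparr>"

text \<open>The edge-dependent model, for \<open>d \<le> m\<close>: the sets \<open>I v\<close>, for \<open>v \<in> {1..n}\<close>, are
  independent, and each is uniform among the \<open>d\<close>-element subsets of \<open>{1..m}\<close>. The second
  argument of \<open>Pi_pmf\<close> is the irrelevant value of \<open>I\<close> outside \<open>{1..n}\<close>.\<close>

definition edge_dependent_model :: "nat \<Rightarrow> nat \<Rightarrow> nat \<Rightarrow> nat hypergraph pmf" where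
  "edge_dependent_model n m d =
     map_pmf (incidence_hypergraph n m)
       (Pi_pmf {1..n} {} (\<lambda>_. pmf_of_set {S. S \<subseteq> {1..m} \<and> card S = d}))"

definition whp :: "(nat \<Rightarrow> 'a pmf) \<Rightarrow> (nat \<Rightarrow> 'a \<Rightarrow> bool) \<Rightarrow> bool" where
  "whp M P \<longleftrightarrow> (\<lambda>n. measure_pmf.prob (M n) {x. P n x}) \<longlonglongrightarrow> 1"

end

theory Submission
  imports Defs
begin

text \<open>
Fix a colouring \<open>\<psi>\<close> and expose the edges one at a time, in the order \<open>e\<^sub>m\<close>, \<open>e\<^sub>m\<^sub>-\<^sub>1\<close>, \<open>\<dots>\<close>. If vertex \<open>v\<close>
still has \<open>r v\<close> incidences to place in \<open>{1..k}\<close>, then, given the history, it joins \<open>e\<^sub>k\<close> with probability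
\<open>r v / k\<close>, independently of the other vertices. So \<open>\<psi>(e\<^sub>k)\<close> is, conditionally, a signed sum of independent
Bernoulli variables, with variance \<open>V\<^sub>k = (\<Sum>v. (r v / k) (1 - r v / k))\<close>. If \<open>\<beta>\<close> bounds the probability
that such a sum of variance at least \<open>W\<close> lies in \<open>(-t, t)\<close>, then the probability that \<open>\<bar>\<psi>(e\<^sub>k)\<bar> < t\<close> and
\<open>V\<^sub>k \<ge> W\<close> for all \<open>k > l\<close> is at most \<open>\<beta> ^ (m - l)\<close> (\<open>sequential_exposure_bound\<close>).

The decisive point is that \<open>V\<^sub>k\<close> does not depend on \<open>\<psi>\<close>. The bound \<open>V\<^sub>k \<ge> W\<close>, with \<open>W\<close> a small multiple of
\<open>d n / m\<close>, may therefore fail with any probability tending to \<open>0\<close>, and only the conditional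
probabilities have to compete with the \<open>2 ^ n\<close> colourings (\<open>disc_prob_union_bound\<close>):
\<open>P (disc H < t) \<le> (\<Sum>k>l. P (V\<^sub>k < W)) + 2 ^ n * \<beta> ^ (m - l)\<close>. The probabilities \<open>P (V\<^sub>k < W)\<close> are
controlled by hypergeometric tail bounds for the individual vertices, combined over the independent
vertices (\<open>exposure_variance_small_prob\<close>). They are small as long as \<open>d k / m\<close> is a large constant.

If \<open>m = O(n)\<close>, a Fourier argument gives \<open>\<beta> = O(t / sqrt (d n / m))\<close> for \<open>t \<ge> 1\<close>
(\<open>bernoulli_signed_sum_interval_le\<close>), which is \<open>2 powr (- n / m) / 16\<close> for the required \<open>t\<close> with \<open>\<kappa>\<close>
suitably small, so that \<open>\<beta> ^ m\<close> beats \<open>2 ^ n\<close>. A number \<open>l\<close> of order \<open>m / d\<close> of edges is lost at the end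
of the exposure, but this costs at most a factor \<open>2 ^ m\<close> (\<open>disc_prob_dense\<close>). Thresholds below \<open>1\<close> are
covered by parity: if the discrepancy is \<open>0\<close>, all edges have even size, and this is unlikely
(\<open>disc_less_one_prob\<close>).

If \<open>n / m\<close> tends to \<open>0\<close>, then \<open>1 - \<beta>\<close> only has to be large compared with \<open>n / m\<close>. A lower bound for the
tails of signed Bernoulli sums, obtained from the Paley--Zygmund inequality for an exponential moment
(\<open>bernoulli_signed_sum_spread\<close>), gives \<open>1 - \<beta> \<ge> \<gamma> powr (- 1/2) / 4 \<ge> sqrt (n / m) / 4\<close> for \<open>t\<close> of order
\<open>sqrt (d n / m * ln \<gamma>)\<close>; exposing half of the edges is then enough (\<open>disc_prob_sparse\<close>).
\<close>

section \<open>Anticoncentration of signed Bernoulli sums\<close>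

lemma bernoulli_signed_sum_char:
  fixes p :: "'a \<Rightarrow> real"
  assumes "finite V" "\<And>v. v \<in> V \<Longrightarrow> 0 \<le> p v \<and> p v \<le> 1"
  shows "measure_pmf.expectation (Pi_pmf V False (\<lambda>v. bernoulli_pmf (p v)))
           (\<lambda>f. cis (\<theta> * real_of_int (edge_sum \<psi> {v\<in>V. f v})))
         = (\<Prod>v\<in>V. of_real (1 - p v) + of_real (p v) * cis (\<theta> * real_of_int (\<psi> v)))"
  using assms
proof (induction V rule: finite_induct)
  case empty
  then show ?case by (simp add: edge_sum_def)
next
  case (insert x V)
  let ?P = "Pi_pmf V False (\<lambda>v. bernoulli_pmf (p v))"
  let ?g = "\<lambda>f. cis (\<theta> * real_of_int (edge_sum \<psi> {v\<in>V. f v}))"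
  have fin: "finite (set_pmf ?P)"
    by (rule finite_subset[OF set_Pi_pmf_subset'[OF insert(1)]])
       (auto intro!: finite_PiE_dflt insert(1))
  have int: "integrable ?P ?g"
    by (rule integrable_measure_pmf_finite[OF fin])
  have es: "cis (\<theta> * real_of_int (edge_sum \<psi> {v \<in> insert x V. (f(x := y)) v}))
     = (if y then cis (\<theta> * real_of_int (\<psi> x)) else 1) * ?g f" for f y
  proof -
    have s: "{v \<in> insert x V. (f(x := y)) v} = (if y then insert x {v\<in>V. f v} else {v\<in>V. f v})"
      using insert(2) by auto
    show ?thesis unfolding s using insert(1,2)
      by (auto simp: edge_sum_def cis_mult algebra_simps)
  qed
  have "measure_pmf.expectation (Pi_pmf (insert x V) False (\<lambda>v. bernoulli_pmf (p v)))
           (\<lambda>f. cis (\<theta> * real_of_int (edge_sum \<psi> {v\<in>insert x V. f v})))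
      = measure_pmf.expectation (bind_pmf (bernoulli_pmf (p x)) (\<lambda>y. map_pmf (\<lambda>f. f(x := y)) ?P))
           (\<lambda>f. cis (\<theta> * real_of_int (edge_sum \<psi> {v\<in>insert x V. f v})))"
    by (subst Pi_pmf_insert'[OF insert(1,2)]) (simp add: map_pmf_def)
  also have "\<dots> = (\<Sum>y\<in>UNIV. pmf (bernoulli_pmf (p x)) y *\<^sub>R
      measure_pmf.expectation (map_pmf (\<lambda>f. f(x := y)) ?P)
        (\<lambda>f. cis (\<theta> * real_of_int (edge_sum \<psi> {v\<in>insert x V. f v}))))"
    by (rule pmf_expectation_bind) (use fin in auto)
  also have "\<dots> = (of_real (1 - p x) + of_real (p x) * cis (\<theta> * real_of_int (\<psi> x)))
      * measure_pmf.expectation ?P ?g"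
    unfolding integral_map_pmf es using insert.prems[of x]
    by (simp add: UNIV_bool scaleR_conv_of_real algebra_simps)
  also have "measure_pmf.expectation ?P ?g = 
     (\<Prod>v\<in>V. of_real (1 - p v) + of_real (p v) * cis (\<theta> * real_of_int (\<psi> v)))"
    using insert by blast
  finally show ?case using insert(1,2) by simp
qed

lemma one_minus_cos_ge:
  fixes x :: real assumes "\<bar>x\<bar> \<le> pi" shows "1 - cos x \<ge> x\<^sup>2 / 12"
proof -
  have "\<exists>t. cos x = (\<Sum>m<4. cos_coeff m * x ^ m) + (cos (t + 1/2 * real 4 * pi) / fact 4) * x ^ 4"
    using Maclaurin_cos_expansion[of x 4] by blast
  then obtain t where t: "cos x = (\<Sum>m<4. cos_coeff m * x ^ m) + (cos (t + 1/2 * real 4 * pi) / fact 4) * x ^ 4"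
    by blast
  have "(\<Sum>m<4. cos_coeff m * x ^ m) = 1 - x\<^sup>2 / 2"
  proof -
    have "{..<4} = {0, 1, 2, 3::nat}" by auto
    then show ?thesis by (simp add: cos_coeff_def)
  qed
  moreover have "(cos (t + 1/2 * real 4 * pi) / fact 4) * x ^ 4 \<le> 1 / 24 * x ^ 4"
    by (intro mult_right_mono) (auto simp: fact_numeral)
  ultimately have c: "cos x \<le> 1 - x\<^sup>2 / 2 + x ^ 4 / 24" using t by linarith
  have "x\<^sup>2 \<le> pi\<^sup>2" using assms by (metis abs_ge_zero power2_abs power_mono)
  also have "\<dots> \<le> 3.15\<^sup>2" using pi_approx by (intro power_mono) auto
  finally have "x\<^sup>2 \<le> 10" by (simp add: power2_eq_square)
  then have "x\<^sup>2 * x\<^sup>2 \<le> 10 * x\<^sup>2" by (intro mult_right_mono) auto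
  moreover have "x ^ 4 = x\<^sup>2 * x\<^sup>2" by (simp add: power_numeral_reduce)
  ultimately show ?thesis using c by linarith
qed

lemma cmod_bernoulli_char:
  fixes p :: real and s :: int
  assumes "0 \<le> p" "p \<le> 1" "s \<in> {-1, 1}"
  shows "cmod (of_real (1 - p) + of_real p * cis (\<theta> * real_of_int s)) \<le> exp (- (p * (1 - p)) * (1 - cos \<theta>))"
proof -
  have "(cmod (of_real (1 - p) + of_real p * cis (\<theta> * real_of_int s)))\<^sup>2
      = (1 - p + p * cos \<theta>)\<^sup>2 + (p * sin \<theta>)\<^sup>2"
    using assms(3) by (auto simp: cmod_power2)
  also have "\<dots> = (1-p)\<^sup>2 + 2 * p * (1-p) * cos \<theta> + p\<^sup>2 * ((cos \<theta>)\<^sup>2 + (sin \<theta>)\<^sup>2)"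
    by algebra
  also have "\<dots> = (1-p)\<^sup>2 + 2 * p * (1-p) * cos \<theta> + p\<^sup>2" by simp
  also have "\<dots> = 1 + (- (2 * (p * (1 - p)) * (1 - cos \<theta>)))"
    by (simp add: power2_eq_square algebra_simps)
  also have "\<dots> \<le> exp (- (2 * (p * (1 - p)) * (1 - cos \<theta>)))" by (rule exp_ge_add_one_self)
  also have "\<dots> = (exp (- (p * (1 - p)) * (1 - cos \<theta>)))\<^sup>2"
    by (simp add: exp_double[symmetric] algebra_simps)
  finally show ?thesis by (rule power2_le_imp_le) simp
qed

text \<open>Fourier inversion for integer-valued variables rests on this orthogonality relation.\<close>

lemma has_integral_cis_int:
  fixes k :: int
  shows "((\<lambda>\<theta>. cis (\<theta> * real_of_int k)) has_integral (if k = 0 then 2 * pi else 0)) {-pi..pi}"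
proof (cases "k = 0")
  case True
  then show ?thesis using has_integral_const_real[of "1::complex" "-pi" pi] 
    by (simp add: scaleR_conv_of_real)
next
  case False
  let ?F = "\<lambda>\<theta>. cis (\<theta> * real_of_int k) / (\<i> * of_int k)"
  have "((\<lambda>\<theta>. cis (\<theta> * real_of_int k)) has_integral (?F pi - ?F (-pi))) {-pi..pi}"
  proof (rule fundamental_theorem_of_calculus)
    fix x :: real
    have "(?F has_vector_derivative (cis (x * real_of_int k) * (\<i> * of_int k)) / (\<i> * of_int k)) (at x within {-pi..pi})"
      unfolding cis_conv_exp
      by (auto intro!: derivative_eq_intros has_vector_derivative_real_field simp: False mult_ac)
    then show "(?F has_vector_derivative cis (x * real_of_int k)) (at x within {-pi..pi})"
      using False by (subst (asm) nonzero_mult_div_cancel_right) auto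
  qed (use pi_gt_zero in linarith)
  moreover have "cis (pi * real_of_int k) = cis (- pi * real_of_int k)"
  proof -
    have "cis (pi * real_of_int k) = cis (- pi * real_of_int k) * cis (2 * pi * real_of_int k)"
      by (simp add: cis_mult algebra_simps)
    also have "cis (2 * pi * real_of_int k) = 1" by (simp add: cis_multiple_2pi)
    finally show ?thesis by simp
  qed
  ultimately show ?thesis using False by simp
qed

lemma integral_inverse_quadratic_le:
  fixes a :: real assumes "a > 0"
  shows "integral {-pi..pi} (\<lambda>\<theta>. 1 / (1 + a\<^sup>2 * \<theta>\<^sup>2)) \<le> pi / a"
proof -
  have "((\<lambda>\<theta>. 1 / (1 + a\<^sup>2 * \<theta>\<^sup>2)) has_integral (arctan (a * pi) / a - arctan (a * (-pi)) / a)) {-pi..pi}"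
    by (rule fundamental_theorem_of_calculus)
       (use assms in \<open>auto intro!: derivative_eq_intros simp: has_real_derivative_iff_has_vector_derivative[symmetric]
          divide_simps power_mult_distrib\<close>)
  then have "integral {-pi..pi} (\<lambda>\<theta>. 1 / (1 + a\<^sup>2 * \<theta>\<^sup>2)) = 2 * arctan (a * pi) / a"
    by (simp add: integral_unique arctan_minus)
  also have "\<dots> \<le> pi / a" using arctan_ubound[of "a * pi"] assms by (intro divide_right_mono) auto
  finally show ?thesis .
qed

text \<open>Integrating the characteristic function over a full period recovers the probability of a single
value. The modulus of each factor is at most \<open>exp (- p (1 - p) (1 - cos \<theta>))\<close>, which does not see the
sign \<open>\<psi> v\<close>, so the integral is bounded in terms of the variance alone. Replacing \<open>exp (- y)\<close> by
\<open>1 / (1 + y)\<close> turns it into an arctangent.\<close>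

lemma bernoulli_signed_sum_point_le:
  fixes p :: "'a \<Rightarrow> real" and \<psi> :: "'a \<Rightarrow> int"
  assumes V: "finite V" and p: "\<And>v. v \<in> V \<Longrightarrow> 0 \<le> p v \<and> p v \<le> 1"
    and \<psi>: "\<And>v. v \<in> V \<Longrightarrow> \<psi> v \<in> {-1, 1}"
    and var: "W \<le> (\<Sum>v\<in>V. p v * (1 - p v))" and W: "W > 0"
  shows "measure_pmf.prob (Pi_pmf V False (\<lambda>v. bernoulli_pmf (p v))) {f. edge_sum \<psi> {v\<in>V. f v} = x}
         \<le> 2 / sqrt W"
proof -
  let ?P = "Pi_pmf V False (\<lambda>v. bernoulli_pmf (p v))"
  let ?X = "\<lambda>f. edge_sum \<psi> {v\<in>V. f v}"
  let ?S = "set_pmf ?P"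
  let ?\<phi> = "\<lambda>\<theta>. measure_pmf.expectation ?P (\<lambda>f. cis (\<theta> * real_of_int (?X f - x)))"
  have fin: "finite ?S"
    by (rule finite_subset[OF set_Pi_pmf_subset'[OF V]]) (auto intro!: finite_PiE_dflt V)
  have \<phi>_sum: "?\<phi> \<theta> = (\<Sum>f\<in>?S. pmf ?P f *\<^sub>R cis (\<theta> * real_of_int (?X f - x)))" for \<theta>
    by (rule integral_measure_pmf[OF fin]) auto
  have prob: "measure_pmf.prob ?P {f. ?X f = x} = (\<Sum>f\<in>?S. pmf ?P f * (if ?X f - x = 0 then 1 else 0))"
  proof -
    have "measure_pmf.prob ?P {f. ?X f = x} = measure_pmf.expectation ?P (indicator {f. ?X f = x})"
      by simp
    also have "\<dots> = (\<Sum>f\<in>?S. pmf ?P f *\<^sub>R indicator {f. ?X f = x} f)"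
      by (rule integral_measure_pmf[OF fin]) auto
    finally show ?thesis by (auto intro!: sum.cong simp: indicator_def)
  qed
  have "(?\<phi> has_integral (\<Sum>f\<in>?S. pmf ?P f *\<^sub>R (if ?X f - x = 0 then 2 * of_real pi else 0))) {-pi..pi}"
    unfolding \<phi>_sum
  proof (intro has_integral_sum fin has_integral_cmul)
    show "((\<lambda>\<theta>. cis (\<theta> * real_of_int (?X f - x))) has_integral
        (if ?X f - x = 0 then 2 * of_real pi else 0)) {-pi..pi}" for f
      using has_integral_cis_int[of "?X f - x"] by (simp split: if_splits)
  qed
  also have "(\<Sum>f\<in>?S. pmf ?P f *\<^sub>R (if ?X f - x = 0 then 2 * of_real pi else (0::complex)))
      = of_real (2 * pi * measure_pmf.prob ?P {f. ?X f = x})"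
    unfolding prob sum_distrib_left of_real_sum
    by (intro sum.cong) (auto simp: scaleR_conv_of_real)
  finally have hi: "(?\<phi> has_integral of_real (2 * pi * measure_pmf.prob ?P {f. ?X f = x})) {-pi..pi}" .
  define a where "a = sqrt (W / 12)"
  have a: "a > 0" "a\<^sup>2 = W / 12" using W by (auto simp: a_def)
  have bound: "cmod (?\<phi> \<theta>) \<le> 1 / (1 + a\<^sup>2 * \<theta>\<^sup>2)" if "\<theta> \<in> {-pi..pi}" for \<theta>
  proof -
    have "?\<phi> \<theta> = measure_pmf.expectation ?P (\<lambda>f. cis (- (\<theta> * real_of_int x)) * cis (\<theta> * real_of_int (?X f)))"
      by (simp add: cis_mult algebra_simps)
    also have "\<dots> = cis (- (\<theta> * real_of_int x)) * measure_pmf.expectation ?P (\<lambda>f. cis (\<theta> * real_of_int (?X f)))"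
      by simp
    finally have "cmod (?\<phi> \<theta>) = cmod (\<Prod>v\<in>V. of_real (1 - p v) + of_real (p v) * cis (\<theta> * real_of_int (\<psi> v)))"
      using bernoulli_signed_sum_char[where \<theta>=\<theta> and \<psi>=\<psi>, OF V p] by (simp add: norm_mult)
    also have "\<dots> \<le> (\<Prod>v\<in>V. exp (- (p v * (1 - p v)) * (1 - cos \<theta>)))"
      unfolding prod_norm[symmetric]
      by (intro prod_mono conjI norm_ge_zero cmod_bernoulli_char) (use p \<psi> in blast)+
    also have "\<dots> = exp (- (1 - cos \<theta>) * (\<Sum>v\<in>V. p v * (1 - p v)))"
      by (simp add: exp_sum[OF V, symmetric] sum_distrib_left algebra_simps)
    also have "\<dots> \<le> exp (- (\<theta>\<^sup>2 / 12) * W)"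
    proof -
      have "\<theta>\<^sup>2 / 12 * W \<le> (1 - cos \<theta>) * (\<Sum>v\<in>V. p v * (1 - p v))"
        using one_minus_cos_ge[of \<theta>] that var W by (intro mult_mono) auto
      then show ?thesis unfolding exp_le_cancel_iff by linarith
    qed
    also have "\<dots> = 1 / exp (a\<^sup>2 * \<theta>\<^sup>2)" by (simp add: a exp_minus field_simps)
    also have "\<dots> \<le> 1 / (1 + a\<^sup>2 * \<theta>\<^sup>2)"
      by (intro divide_left_mono exp_ge_add_one_self mult_pos_pos) (auto intro: add_pos_nonneg)
    finally show ?thesis .
  qed
  have "continuous_on {-pi..pi} (\<lambda>\<theta>. 1 / (1 + a\<^sup>2 * \<theta>\<^sup>2))"
    by (intro continuous_intros) (metis add_pos_nonneg less_irrefl mult_nonneg_nonneg zero_le_power2 zero_less_one)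
  then have "(\<lambda>\<theta>. 1 / (1 + a\<^sup>2 * \<theta>\<^sup>2)) integrable_on {-pi..pi}"
    by (rule integrable_continuous_real)
  then have "cmod (integral {-pi..pi} ?\<phi>) \<le> integral {-pi..pi} (\<lambda>\<theta>. 1 / (1 + a\<^sup>2 * \<theta>\<^sup>2))"
    using hi bound by (intro integral_norm_bound_integral) auto
  also have "\<dots> \<le> pi / a" by (rule integral_inverse_quadratic_le[OF a(1)])
  finally have "2 * pi * measure_pmf.prob ?P {f. ?X f = x} \<le> pi / a"
    unfolding integral_unique[OF hi] norm_of_real by simp
  then have "measure_pmf.prob ?P {f. ?X f = x} \<le> 1 / (2 * a)"
    using pi_gt_zero a by (simp add: field_simps)
  also have "\<dots> \<le> 2 / sqrt W"
  proof -
    have "sqrt W / 4 \<le> sqrt (W / 12)"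
      using W real_sqrt_le_mono[of "W / 16" "W / 12"] by (simp add: real_sqrt_divide)
    then have "sqrt W \<le> 4 * a" unfolding a_def by linarith
    then show ?thesis using a W by (simp add: field_simps)
  qed
  finally show ?thesis .
qed

text \<open>An interval of radius \<open>t \<ge> 1\<close> contains at most \<open>2 t + 1 \<le> 3 t\<close> integers. This is where \<open>t \<ge> 1\<close>
matters: below that scale the lattice structure makes the bound false.\<close>

lemma bernoulli_signed_sum_interval_le:
  fixes p :: "'a \<Rightarrow> real" and \<psi> :: "'a \<Rightarrow> int" and t :: real
  assumes V: "finite V" and p: "\<And>v. v \<in> V \<Longrightarrow> 0 \<le> p v \<and> p v \<le> 1"
    and \<psi>: "\<And>v. v \<in> V \<Longrightarrow> \<psi> v \<in> {-1, 1}"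
    and var: "W \<le> (\<Sum>v\<in>V. p v * (1 - p v))" and W: "W > 0" and t: "t \<ge> 1"
  shows "measure_pmf.prob (Pi_pmf V False (\<lambda>v. bernoulli_pmf (p v)))
           {f. \<bar>real_of_int (edge_sum \<psi> {v\<in>V. f v})\<bar> < t} \<le> 6 * t / sqrt W"
proof -
  let ?P = "Pi_pmf V False (\<lambda>v. bernoulli_pmf (p v))"
  let ?X = "\<lambda>f. edge_sum \<psi> {v\<in>V. f v}"
  define N where "N = \<lfloor>t\<rfloor>"
  have N: "N \<ge> 1" "real_of_int N \<le> t" using t by (auto simp: N_def)
  have "{f. \<bar>real_of_int (?X f)\<bar> < t} \<subseteq> (\<Union>x\<in>{-N..N}. {f. ?X f = x})"
  proof
    fix f assume "f \<in> {f. \<bar>real_of_int (?X f)\<bar> < t}"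
    then have "\<bar>?X f\<bar> \<le> N" unfolding N_def by (simp add: le_floor_iff) 
    then have "?X f \<in> {-N..N}" by auto
    then show "f \<in> (\<Union>x\<in>{-N..N}. {f. ?X f = x})" by auto
  qed
  then have "measure_pmf.prob ?P {f. \<bar>real_of_int (?X f)\<bar> < t}
      \<le> measure_pmf.prob ?P (\<Union>x\<in>{-N..N}. {f. ?X f = x})"
    by (intro measure_pmf.finite_measure_mono) auto
  also have "\<dots> \<le> (\<Sum>x\<in>{-N..N}. measure_pmf.prob ?P {f. ?X f = x})"
    by (intro measure_pmf.finite_measure_subadditive_finite) auto
  also have "\<dots> \<le> (\<Sum>x\<in>{-N..N}. 2 / sqrt W)"
    by (intro sum_mono bernoulli_signed_sum_point_le[OF V p \<psi> var W])
  also have "\<dots> = (2 * real_of_int N + 1) * (2 / sqrt W)" using N by simp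
  also have "\<dots> \<le> (3 * t) * (2 / sqrt W)" using N W by (intro mult_right_mono) auto
  finally show ?thesis by simp
qed

section \<open>Large deviations of signed Bernoulli sums\<close>

lemma exp_le_one_plus_plus_sq:
  fixes x :: real assumes "\<bar>x\<bar> \<le> 1" shows "exp x \<le> 1 + x + x\<^sup>2"
proof (cases "x \<ge> 0")
  case True
  then show ?thesis using exp_bound[of x] assms by simp
next
  case False
  obtain t where "exp x = (\<Sum>m<3. x ^ m / fact m) + exp t / fact 3 * x ^ 3"
    using Maclaurin_exp_le[of x 3] by blast
  moreover have "exp t / fact 3 * x ^ 3 \<le> 0"
    using False by (intro mult_nonneg_nonpos) (auto simp: power_le_zero_eq)
  ultimately have "exp x \<le> 1 + x + x\<^sup>2 / 2"
    by (simp add: numeral_3_eq_3 power2_eq_square)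
  then show ?thesis by (smt (verit) zero_le_power2 field_sum_of_halves)
qed

lemma one_plus_plus_sq_le_exp:
  fixes x :: real assumes "\<bar>x\<bar> \<le> 1" shows "1 + x + x\<^sup>2 / 3 \<le> exp x"
proof -
  obtain t where t: "exp x = (\<Sum>m<4. x ^ m / fact m) + exp t / fact 4 * x ^ 4"
    using Maclaurin_exp_le[of x 4] by blast
  have "{..<4} = {0, 1, 2, 3::nat}" by auto
  then have "(\<Sum>m<4. x ^ m / fact m) = 1 + x + x\<^sup>2 / 2 + x ^ 3 / 6"
    by (simp add: fact_numeral)
  moreover have "exp t / fact 4 * x ^ 4 \<ge> 0" by simp
  moreover have "x ^ 3 \<ge> - x\<^sup>2"
  proof -
    have "0 \<le> x\<^sup>2 * (x + 1)" using assms by (intro mult_nonneg_nonneg) auto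
    then show ?thesis by (simp add: power2_eq_square power3_eq_cube algebra_simps)
  qed
  ultimately show ?thesis using t by linarith
qed

text \<open>The usual derivation applies the Cauchy--Schwarz inequality to \<open>Z\<close> times the indicator of the event.
Here that inequality is replaced by the pointwise estimate
\<open>Z \<le> c Z\<^sup>2 / 2 + 1 / (2 c)\<close> on the event, with the constant \<open>c\<close> that makes the final bound optimal.\<close>

lemma paley_zygmund:
  fixes Z :: "'a \<Rightarrow> real"
  assumes fin: "finite (set_pmf P)" and nn: "\<And>x. Z x \<ge> 0"
    and pos: "measure_pmf.expectation P Z > 0" "measure_pmf.expectation P (\<lambda>x. (Z x)\<^sup>2) > 0"
  shows "(measure_pmf.expectation P Z)\<^sup>2 / 4
     \<le> measure_pmf.expectation P (\<lambda>x. (Z x)\<^sup>2) * measure_pmf.prob P {x. Z x \<ge> measure_pmf.expectation P Z / 2}"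
proof -
  let ?E = "measure_pmf.expectation P"
  define \<mu> where "\<mu> = ?E Z"
  define S where "S = ?E (\<lambda>x. (Z x)\<^sup>2)"
  define A where "A = {x. Z x \<ge> \<mu> / 2}"
  define c where "c = \<mu> / (2 * S)"
  have pos': "\<mu> > 0" "S > 0" "c > 0" using pos by (auto simp: \<mu>_def S_def c_def)
  have int: "integrable (measure_pmf P) f" for f :: "'a \<Rightarrow> real"
    by (rule integrable_measure_pmf_finite[OF fin])
  have pw: "Z x \<le> \<mu> / 2 + (c / 2 * (Z x)\<^sup>2 + 1 / (2 * c) * indicator A x)" for x
  proof (cases "x \<in> A")
    case True
    have "0 \<le> (c * Z x - 1)\<^sup>2 / (2 * c)" using pos' by simp
    also have "\<dots> = c / 2 * (Z x)\<^sup>2 + 1 / (2 * c) - Z x"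
      using pos' by (simp add: power2_eq_square field_simps)
    finally show ?thesis using True pos' by simp
  next
    case False
    moreover have "0 \<le> c / 2 * (Z x)\<^sup>2" using pos' by simp
    ultimately show ?thesis by (simp add: A_def)
  qed
  have "\<mu> \<le> ?E (\<lambda>x. \<mu> / 2 + (c / 2 * (Z x)\<^sup>2 + 1 / (2 * c) * indicator A x))"
    unfolding \<mu>_def by (intro integral_mono int) (use pw in \<open>simp add: \<mu>_def\<close>)
  also have "\<dots> = \<mu> / 2 + (c / 2 * S + 1 / (2 * c) * measure_pmf.prob P A)"
    unfolding S_def
    by (subst Bochner_Integration.integral_add[OF int int])+ simp
  finally have "\<mu> / 2 - c / 2 * S \<le> 1 / (2 * c) * measure_pmf.prob P A" by linarith
  then have "\<mu> / 4 \<le> S / \<mu> * measure_pmf.prob P A"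
    using pos' by (simp add: c_def)
  then have "\<mu> * (\<mu> / 4) \<le> \<mu> * (S / \<mu> * measure_pmf.prob P A)"
    using pos' by (intro mult_left_mono) auto
  then show ?thesis using pos' by (simp add: power2_eq_square \<mu>_def S_def A_def)
qed

text \<open>For bounded tilts the exponential moment of a centred Bernoulli variable is, up to constants in the
exponent, that of a Gaussian with the same variance. The lower bound is what makes a large-deviation
lower bound possible.\<close>

lemma bernoulli_centred_exp_moment:
  fixes p a :: real
  assumes p: "0 \<le> p" "p \<le> 1" and a: "\<bar>a\<bar> \<le> 1"
  defines "M \<equiv> p * exp (a * (1 - p)) + (1 - p) * exp (- (a * p))"
  shows "exp (a\<^sup>2 * (p * (1 - p)) / 4) \<le> M" "M \<le> exp (a\<^sup>2 * (p * (1 - p)))"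
proof -
  have ab: "\<bar>a * (1 - p)\<bar> \<le> 1" "\<bar>- (a * p)\<bar> \<le> 1"
    using p a by (auto simp: abs_mult mult_le_one)
  let ?q = "a\<^sup>2 * (p * (1 - p))"
  have "M \<le> p * (1 + a * (1 - p) + (a * (1 - p))\<^sup>2) + (1 - p) * (1 + (- (a * p)) + (- (a * p))\<^sup>2)"
    unfolding M_def using p by (intro add_mono mult_left_mono exp_le_one_plus_plus_sq ab) auto
  also have "\<dots> = 1 + ?q" by (simp add: power2_eq_square algebra_simps)
  also have "\<dots> \<le> exp ?q" by (rule exp_ge_add_one_self)
  finally show "M \<le> exp ?q" .
  have q: "0 \<le> ?q" "?q \<le> 1 / 4"
  proof -
    show "0 \<le> ?q" using p by simp
    have "p * (1 - p) = 1 / 4 - (p - 1 / 2)\<^sup>2" by (simp add: power2_eq_square algebra_simps)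
    then have "p * (1 - p) \<le> 1 / 4" by simp
    moreover have "a\<^sup>2 \<le> 1" using a by (simp add: abs_square_le_1)
    ultimately have "?q \<le> 1 * (1 / 4)" using p by (intro mult_mono) auto
    then show "?q \<le> 1 / 4" by simp
  qed
  have "exp (?q / 4) \<le> 1 + ?q / 4 + (?q / 4)\<^sup>2"
    using q by (intro exp_le_one_plus_plus_sq) auto
  also have "(?q / 4)\<^sup>2 \<le> ?q / 4 * (1 / 16)"
    using mult_left_mono[of "?q / 4" "1 / 16" "?q / 4"] q
    unfolding power2_eq_square[of "?q / 4"] by linarith
  also have "1 + ?q / 4 + ?q / 4 * (1 / 16) \<le> 1 + ?q / 3" using q by linarith
  also have "\<dots> = p * (1 + a * (1 - p) + (a * (1 - p))\<^sup>2 / 3) + (1 - p) * (1 + (- (a * p)) + (- (a * p))\<^sup>2 / 3)"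
    by (simp add: power2_eq_square field_simps)
  also have "\<dots> \<le> M"
    unfolding M_def using p by (intro add_mono mult_left_mono one_plus_plus_sq_le_exp ab) auto
  finally show "exp (?q / 4) \<le> M" by simp
qed

lemma bernoulli_signed_sum_exp_moment:
  fixes p :: "'a \<Rightarrow> real" and a :: "'a \<Rightarrow> real"
  assumes V: "finite V" and p: "\<And>v. v \<in> V \<Longrightarrow> 0 \<le> p v \<and> p v \<le> 1"
    and a: "\<And>v. v \<in> V \<Longrightarrow> \<bar>a v\<bar> = b" and b: "b \<le> 1"
  defines "S \<equiv> \<Sum>v\<in>V. p v * (1 - p v)"
  defines "M \<equiv> measure_pmf.expectation (Pi_pmf V False (\<lambda>v. bernoulli_pmf (p v)))
      (\<lambda>f. exp (\<Sum>v\<in>V. a v * (of_bool (f v) - p v)))"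
  shows "exp (b\<^sup>2 * S / 4) \<le> M" "M \<le> exp (b\<^sup>2 * S)"
proof -
  let ?m = "\<lambda>v. p v * exp (a v * (1 - p v)) + (1 - p v) * exp (- (a v * p v))"
  have "M = measure_pmf.expectation (Pi_pmf V False (\<lambda>v. bernoulli_pmf (p v)))
      (\<lambda>f. \<Prod>v\<in>V. exp (a v * (of_bool (f v) - p v)))"
    unfolding M_def by (simp add: exp_sum[OF V])
  also have "\<dots> = (\<Prod>v\<in>V. measure_pmf.expectation (bernoulli_pmf (p v)) (\<lambda>y. exp (a v * (of_bool y - p v))))"
    by (rule expectation_prod_Pi_pmf[OF V]) (auto intro: integrable_measure_pmf_finite)
  also have "\<dots> = (\<Prod>v\<in>V. ?m v)"
    using p by (intro prod.cong) auto
  finally have M: "M = (\<Prod>v\<in>V. ?m v)" .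
  have ab: "(a v)\<^sup>2 = b\<^sup>2" if "v \<in> V" for v using a[OF that] by (metis power2_abs)
  have bd: "exp ((a v)\<^sup>2 * (p v * (1 - p v)) / 4) \<le> ?m v" "?m v \<le> exp ((a v)\<^sup>2 * (p v * (1 - p v)))"
    if "v \<in> V" for v
    using bernoulli_centred_exp_moment[of "p v" "a v"] p a b that by auto
  have "exp (b\<^sup>2 * S / 4) = (\<Prod>v\<in>V. exp ((a v)\<^sup>2 * (p v * (1 - p v)) / 4))"
    unfolding S_def exp_sum[OF V, symmetric] sum_distrib_left sum_divide_distrib
    by (auto intro!: sum.cong simp: ab)
  also have "\<dots> \<le> M" unfolding M by (intro prod_mono) (use bd in auto)
  finally show "exp (b\<^sup>2 * S / 4) \<le> M" .
  have "M \<le> (\<Prod>v\<in>V. exp ((a v)\<^sup>2 * (p v * (1 - p v))))"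
    unfolding M by (intro prod_mono conjI bd) (use p in \<open>auto intro!: add_nonneg_nonneg mult_nonneg_nonneg\<close>)
  also have "\<dots> = exp (b\<^sup>2 * S)"
    unfolding S_def exp_sum[OF V, symmetric] sum_distrib_left
    by (auto intro!: sum.cong simp: ab)
  finally show "M \<le> exp (b\<^sup>2 * S)" .
qed

text \<open>The sum deviates from its mean by \<open>sqrt (L W) / 8\<close> with probability at least \<open>exp (- 4 L) / 4\<close>, in
either prescribed direction. For the tilt \<open>b\<close> with \<open>b\<^sup>2 S = L\<close>, where \<open>S\<close> is the actual variance,
\<open>Z = exp (b (X - E X))\<close> has mean between \<open>exp (L / 4)\<close> and \<open>exp L\<close> and second moment at most
\<open>exp (4 L)\<close>, so by the Paley--Zygmund inequality it is often at least half its mean. Tilting according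
to \<open>S\<close> rather than its lower bound \<open>W\<close> keeps these moments under control however large \<open>S\<close> is. The
sum need not be centred, so the direction of the deviation is chosen to be the sign of the mean.\<close>

lemma bernoulli_signed_sum_spread:
  fixes p :: "'a \<Rightarrow> real" and \<psi> :: "'a \<Rightarrow> int"
  assumes V: "finite V" and p: "\<And>v. v \<in> V \<Longrightarrow> 0 \<le> p v \<and> p v \<le> 1"
    and \<psi>: "\<And>v. v \<in> V \<Longrightarrow> \<psi> v \<in> {-1, 1}"
    and var: "W \<le> (\<Sum>v\<in>V. p v * (1 - p v))" and L: "8 * ln 2 \<le> L" "4 * L \<le> W"
  shows "measure_pmf.prob (Pi_pmf V False (\<lambda>v. bernoulli_pmf (p v)))
           {f. \<bar>real_of_int (edge_sum \<psi> {v\<in>V. f v})\<bar> < sqrt (L * W) / 8} \<le> 1 - exp (- 4 * L) / 4"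
proof -
  let ?P = "Pi_pmf V False (\<lambda>v. bernoulli_pmf (p v))"
  let ?E = "measure_pmf.expectation ?P"
  define X where "X = (\<lambda>f. real_of_int (edge_sum \<psi> {v\<in>V. f v}))"
  define S where "S = (\<Sum>v\<in>V. p v * (1 - p v))"
  define m where "m = (\<Sum>v\<in>V. real_of_int (\<psi> v) * p v)"
  \<comment> \<open>Deviating in the direction of the mean moves the sum away from zero.\<close>
  define s :: real where "s = (if m \<ge> 0 then 1 else -1)"
  define b where "b = sqrt (L / S)"
  define Z where "Z = (\<lambda>f. exp (s * b * (X f - m)))"
  have "0 < ln (2::real)" by simp
  then have Lpos: "0 < L" using L by linarith
  then have S: "0 < S" "W \<le> S" "4 * L \<le> S" using L var by (auto simp: S_def)
  have s: "s * m \<ge> 0" "\<bar>s\<bar> = 1" by (auto simp: s_def)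
  have b2: "b\<^sup>2 * S = L" using S Lpos by (simp add: b_def)
  have b: "0 < b" using S Lpos by (simp add: b_def)
  have "(2 * b)\<^sup>2 \<le> 1" using S Lpos by (simp add: b_def power_mult_distrib field_simps)
  then have b1: "2 * b \<le> 1" by (intro power2_le_imp_le[of "2 * b" 1]) auto
  have fin: "finite (set_pmf ?P)"
    by (rule finite_subset[OF set_Pi_pmf_subset'[OF V]]) (auto intro!: finite_PiE_dflt V)
  have X_sum: "X f - m = (\<Sum>v\<in>V. real_of_int (\<psi> v) * (of_bool (f v) - p v))" for f
  proof -
    have "X f = (\<Sum>v\<in>V. real_of_int (\<psi> v) * of_bool (f v))"
      unfolding X_def edge_sum_def using V by (simp add: sum.inter_filter of_bool_def if_distrib cong: if_cong)
    then show ?thesis by (simp add: m_def sum_subtractf algebra_simps)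
  qed
  have abs\<psi>: "\<bar>real_of_int (\<psi> v)\<bar> = 1" if "v \<in> V" for v using \<psi>[OF that] by auto
  have ZE: "exp (\<Sum>v\<in>V. (c * s * b * real_of_int (\<psi> v)) * (of_bool (f v) - p v)) = exp (c * (s * b * (X f - m)))" for f c
    unfolding X_sum by (simp add: sum_distrib_left mult.assoc)
  have M1: "exp (L / 4) \<le> ?E Z"
    using bernoulli_signed_sum_exp_moment(1)[where a="\<lambda>v. 1 * s * b * real_of_int (\<psi> v)" and b=b and p=p, OF V p]
      abs\<psi> s b b1 unfolding ZE S_def[symmetric] b2 by (simp add: Z_def abs_mult)
  have M2: "?E (\<lambda>f. (Z f)\<^sup>2) \<le> exp (4 * L)" "0 < ?E (\<lambda>f. (Z f)\<^sup>2)"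
  proof -
    have "?E (\<lambda>f. exp (2 * (s * b * (X f - m)))) \<le> exp ((2 * b)\<^sup>2 * S)"
      using bernoulli_signed_sum_exp_moment(2)[where a="\<lambda>v. 2 * s * b * real_of_int (\<psi> v)" and b="2 * b" and p=p, OF V p]
        abs\<psi> s b b1 unfolding ZE S_def[symmetric] by (simp add: abs_mult)
    moreover have "(2 * b)\<^sup>2 * S = 4 * L" using b2 by (simp add: power_mult_distrib)
    moreover have sq: "(Z f)\<^sup>2 = exp (2 * (s * b * (X f - m)))" for f unfolding Z_def exp_double ..
    ultimately show "?E (\<lambda>f. (Z f)\<^sup>2) \<le> exp (4 * L)" by (simp only:)
    have "0 < exp ((2 * b)\<^sup>2 * S / 4)" by simp
    also have "\<dots> \<le> ?E (\<lambda>f. exp (2 * (s * b * (X f - m))))"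
      using bernoulli_signed_sum_exp_moment(1)[where a="\<lambda>v. 2 * s * b * real_of_int (\<psi> v)" and b="2 * b" and p=p, OF V p]
        abs\<psi> s b b1 unfolding ZE S_def[symmetric] by (simp add: abs_mult)
    finally show "0 < ?E (\<lambda>f. (Z f)\<^sup>2)" using sq by (simp only:)
  qed
  have EZ: "1 \<le> ?E Z" using M1 Lpos by (smt (verit) one_le_exp_iff divide_nonneg_nonneg)
  from M2(2) have "(?E Z)\<^sup>2 / 4 \<le> ?E (\<lambda>f. (Z f)\<^sup>2) * measure_pmf.prob ?P {f. Z f \<ge> ?E Z / 2}"
    using EZ by (intro paley_zygmund fin) (auto simp: Z_def)
  also have "\<dots> \<le> exp (4 * L) * measure_pmf.prob ?P {f. Z f \<ge> ?E Z / 2}"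
    by (intro mult_right_mono M2(1)) auto
  finally have "1 / 4 \<le> exp (4 * L) * measure_pmf.prob ?P {f. Z f \<ge> ?E Z / 2}"
    using one_le_power[OF EZ, of 2] by linarith
  then have pr: "exp (- 4 * L) / 4 \<le> measure_pmf.prob ?P {f. Z f \<ge> ?E Z / 2}"
    by (simp add: exp_minus field_simps)
  have sub: "{f. Z f \<ge> ?E Z / 2} \<subseteq> - {f. \<bar>X f\<bar> < sqrt (L * W) / 8}"
  proof
    fix f assume "f \<in> {f. Z f \<ge> ?E Z / 2}"
    then have "exp (L / 4 - ln 2) \<le> Z f" using M1 by (simp add: exp_diff)
    then have "L / 4 - ln 2 \<le> s * b * (X f - m)" by (simp add: Z_def)
    then have "L / 8 \<le> s * b * (X f - m)" using L by linarith
    also have "\<dots> \<le> b * (s * X f)" using s b by (simp add: algebra_simps)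
    also have "\<dots> \<le> b * \<bar>X f\<bar>" using b s by (intro mult_left_mono) (auto simp: s_def)
    finally have "b\<^sup>2 * S / 8 \<le> b * \<bar>X f\<bar>" by (simp add: b2)
    then have "b * (b * S / 8) \<le> b * \<bar>X f\<bar>" by (simp add: power2_eq_square mult.assoc)
    then have 1: "b * S / 8 \<le> \<bar>X f\<bar>" using b by simp
    have "sqrt (L * W) \<le> sqrt (L * S)" using S Lpos by simp
    also have "\<dots> = b * S" using S by (simp add: b_def real_sqrt_mult real_sqrt_divide field_simps)
    finally show "f \<in> - {f. \<bar>X f\<bar> < sqrt (L * W) / 8}" using 1 by auto
  qed
  have "exp (- 4 * L) / 4 \<le> measure_pmf.prob ?P (- {f. \<bar>X f\<bar> < sqrt (L * W) / 8})"
    by (rule order_trans[OF pr measure_pmf.finite_measure_mono[OF sub]]) simp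
  also have "\<dots> = 1 - measure_pmf.prob ?P {f. \<bar>X f\<bar> < sqrt (L * W) / 8}"
    by (subst measure_pmf.prob_compl[symmetric]) (auto simp: Compl_eq_Diff_UNIV)
  finally show ?thesis unfolding X_def by linarith
qed

section \<open>Uniformly random subsets of fixed size\<close>

lemma pmf_markov:
  fixes Z :: "'a \<Rightarrow> real"
  assumes fin: "finite (set_pmf P)" and Z: "\<And>s. Z s \<ge> 0" and c: "c > 0"
  shows "measure_pmf.prob P {s. c \<le> Z s} \<le> measure_pmf.expectation P Z / c"
  using integral_Markov_inequality_measure[OF integrable_measure_pmf_finite[OF fin, of Z], of "{}" c] Z c
  by simp

lemma binomial_avoidance_le:
  assumes "a \<le> m" "m > 0"
  shows "real ((m - a) choose d) \<le> (1 - real d / real m) ^ a * real (m choose d)"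
  using assms(1)
proof (induction a)
  case (Suc a)
  define N where "N = m - a"
  have N: "N > 0" "m - Suc a = N - 1" "N \<le> m" using Suc.prems by (auto simp: N_def)
  show ?case
  proof (cases "d \<le> N")
    case True
    have "real N * real ((N - 1) choose d) = real (N - d) * real (N choose d)"
      unfolding of_nat_mult[symmetric] by (simp only: binomial_absorb_comp)
    then have "real ((N - 1) choose d) = (1 - real d / real N) * real (N choose d)"
      using True N by (simp add: field_simps of_nat_diff)
    also have "\<dots> \<le> (1 - real d / real m) * real (N choose d)"
      using N by (intro mult_right_mono diff_left_mono divide_left_mono) auto
    also have "\<dots> \<le> (1 - real d / real m) * ((1 - real d / real m) ^ a * real (m choose d))"
      using Suc True N by (intro mult_left_mono) (auto simp: N_def field_simps)
    finally show ?thesis by (simp add: N mult.assoc)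
  next
    case False
    then have z: "N - 1 choose d = 0" by simp
    show ?thesis
    proof (cases "d \<le> m")
      case True
      then show ?thesis unfolding N z using assms by (auto intro!: mult_nonneg_nonneg zero_le_power)
    next
      case f: False
      then have "m choose d = 0" by simp
      show ?thesis unfolding N z \<open>m choose d = 0\<close> by simp
    qed
  qed
qed auto

lemma finite_subsets_card: "finite {S. S \<subseteq> {1..m::nat} \<and> card S = d}"
  by (rule finite_subset[of _ "Pow {1..m}"]) auto

lemma card_subsets_interval: "card {S. S \<subseteq> {1..m::nat} \<and> card S = d} = m choose d"
  using n_subsets[of "{1..m}" d] by simp

lemma subsets_card_nonempty: "d \<le> m \<Longrightarrow> {S. S \<subseteq> {1..m::nat} \<and> card S = d} \<noteq> {}"
  using card_subsets_interval[of m d] zero_less_binomial[of d m] by (metis card.empty less_irrefl)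

lemma finite_set_uniform_subset:
  assumes "d \<le> m" shows "finite (set_pmf (pmf_of_set {S. S \<subseteq> {1..m::nat} \<and> card S = d}))"
  unfolding set_pmf_of_set[OF subsets_card_nonempty[OF assms] finite_subsets_card] by (rule finite_subsets_card)

lemma uniform_subset_avoid_prob:
  assumes "d \<le> m" "m > 0" and A: "A \<subseteq> {1..m}"
  shows "measure_pmf.prob (pmf_of_set {S. S \<subseteq> {1..m} \<and> card S = d}) {S. A \<inter> S = {}} 
    \<le> (1 - real d / real m) ^ card A"
proof -
  let ?\<Omega> = "{S. S \<subseteq> {1..m} \<and> card S = d}"
  have finA: "finite A" using A finite_subset by blast
  have "?\<Omega> \<inter> {S. A \<inter> S = {}} = {S. S \<subseteq> {1..m} - A \<and> card S = d}" by auto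
  then have "card (?\<Omega> \<inter> {S. A \<inter> S = {}}) = card ({1..m} - A) choose d"
    using n_subsets[of "{1..m} - A" d] by simp
  also have "card ({1..m} - A) = m - card A" using card_Diff_subset[OF finA A] by simp
  finally have "measure_pmf.prob (pmf_of_set ?\<Omega>) {S. A \<inter> S = {}} = real ((m - card A) choose d) / real (m choose d)"
    by (subst measure_pmf_of_set[OF subsets_card_nonempty[OF assms(1)] finite_subsets_card])
       (simp only: card_subsets_interval)
  also have "\<dots> \<le> (1 - real d / real m) ^ card A"
  proof -
    have "card A \<le> m" using card_mono[OF _ A] by simp
    from binomial_avoidance_le[OF this assms(2), of d] show ?thesis
      using assms(1) by (simp add: divide_le_eq)
  qed
  finally show ?thesis .
qed

text \<open>The probability generating function of the hypergeometric distribution is dominated by that of the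
binomial distribution with the same mean (Hoeffding's comparison). For \<open>z \<le> 1\<close> one writes
\<open>z ^ card (S \<inter> K)\<close> as a product of factors \<open>z + (1 - z) [i \<notin> S]\<close>. All terms of the expansion are
nonnegative, and each involves only the probability that \<open>S\<close> avoids a set, which is at most what
independent choices would give.\<close>

lemma uniform_subset_generating_function_le:
  fixes z :: real
  assumes dm: "d \<le> m" "m > 0" and K: "K \<subseteq> {1..m}" and z: "0 \<le> z" "z \<le> 1"
  shows "measure_pmf.expectation (pmf_of_set {S. S \<subseteq> {1..m} \<and> card S = d}) (\<lambda>S. z ^ card (S \<inter> K)) 
    \<le> (1 - (1 - z) * (real d / real m)) ^ card K"
proof -
  let ?P = "pmf_of_set {S. S \<subseteq> {1..m} \<and> card S = d}"
  let ?q = "1 - real d / real m"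
  have finK: "finite K" using K finite_subset by blast
  have fin: "finite (set_pmf ?P)"
    by (rule finite_set_uniform_subset[OF dm(1)])
  have int: "integrable (measure_pmf ?P) f" for f :: "nat set \<Rightarrow> real"
    by (rule integrable_measure_pmf_finite[OF fin])
  have expand: "z ^ card (S \<inter> K)
      = (\<Sum>A\<in>Pow K. (1 - z) ^ card A * z ^ card (K - A) * indicator {S. A \<inter> S = {}} S)" for S
  proof -
    have "z ^ card (S \<inter> K) = (\<Prod>i\<in>K. if i \<in> S then z else 1)"
      using finK by (simp add: prod.If_cases Int_commute)
    also have "\<dots> = (\<Prod>i\<in>K. (1 - z) * of_bool (i \<notin> S) + z)"
      by (intro prod.cong) auto
    also have "\<dots> = (\<Sum>A\<in>Pow K. (\<Prod>i\<in>A. (1 - z) * of_bool (i \<notin> S)) * (\<Prod>i\<in>K - A. z))"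
      by (rule prod_add[OF finK])
    also have "\<dots> = (\<Sum>A\<in>Pow K. (1 - z) ^ card A * z ^ card (K - A) * indicator {S. A \<inter> S = {}} S)"
    proof (intro sum.cong refl)
      fix A assume "A \<in> Pow K"
      then have "finite A" using finK finite_subset by blast
      then have "(\<Prod>i\<in>A. of_bool (i \<notin> S)) = (indicator {S. A \<inter> S = {}} S :: real)"
        by (cases "A \<inter> S = {}") (auto simp: indicator_def prod_zero_iff intro!: prod.neutral)
      then show "(\<Prod>i\<in>A. (1 - z) * of_bool (i \<notin> S)) * (\<Prod>i\<in>K - A. z)
        = (1 - z) ^ card A * z ^ card (K - A) * indicator {S. A \<inter> S = {}} S"
        by (simp add: prod.distrib)
    qed
    finally show ?thesis .
  qed
  have "measure_pmf.expectation ?P (\<lambda>S. z ^ card (S \<inter> K)) 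
      = (\<Sum>A\<in>Pow K. (1 - z) ^ card A * z ^ card (K - A) * measure_pmf.prob ?P {S. A \<inter> S = {}})"
    unfolding expand by (subst Bochner_Integration.integral_sum[OF int]) simp
  also have "\<dots> \<le> (\<Sum>A\<in>Pow K. (1 - z) ^ card A * z ^ card (K - A) * ?q ^ card A)"
    using K z by (intro sum_mono mult_left_mono uniform_subset_avoid_prob dm) auto
  also have "\<dots> = (\<Sum>A\<in>Pow K. (\<Prod>i\<in>A. (1 - z) * ?q) * (\<Prod>i\<in>K - A. z))"
    by (simp add: power_mult_distrib mult_ac)
  also have "\<dots> = (\<Prod>i\<in>K. (1 - z) * ?q + z)"
    by (rule prod_add[OF finK, symmetric])
  also have "\<dots> = (1 - (1 - z) * (real d / real m)) ^ card K" by (simp add: algebra_simps)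
  finally show ?thesis .
qed

text \<open>Chernoff's argument with the fixed parameter \<open>z = 1/2\<close>.\<close>

lemma uniform_subset_lower_tail:
  assumes dm: "d \<le> m" "m > 0" and K: "K \<subseteq> {1..m}"
  defines "\<mu> \<equiv> real d * real (card K) / real m"
  shows "measure_pmf.prob (pmf_of_set {S. S \<subseteq> {1..m} \<and> card S = d}) {S. real (card (S \<inter> K)) < \<mu> / 4}
    \<le> exp (- \<mu> / 4)"
proof -
  let ?P = "pmf_of_set {S. S \<subseteq> {1..m} \<and> card S = d}"
  have fin: "finite (set_pmf ?P)"
    by (rule finite_set_uniform_subset[OF dm(1)])
  have \<mu>0: "\<mu> \<ge> 0" by (simp add: \<mu>_def)
  define c where "c = (1/2) powr (\<mu> / 4)"
  have c: "c > 0" by (simp add: c_def)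
  have "measure_pmf.prob ?P {S. real (card (S \<inter> K)) < \<mu> / 4} \<le> measure_pmf.prob ?P {S. c \<le> (1/2) ^ card (S \<inter> K)}"
  proof (intro measure_pmf.finite_measure_mono subsetI CollectI)
    fix S assume "S \<in> {S. real (card (S \<inter> K)) < \<mu> / 4}"
    then have "(1/2) powr (\<mu> / 4) \<le> (1/2::real) powr real (card (S \<inter> K))"
      by (intro powr_mono') auto
    then show "c \<le> (1/2) ^ card (S \<inter> K)" by (simp add: c_def powr_realpow)
  qed auto
  also have "\<dots> \<le> measure_pmf.expectation ?P (\<lambda>S. (1/2) ^ card (S \<inter> K)) / c"
    by (rule pmf_markov[OF fin _ c]) simp
  also have "\<dots> \<le> exp (- \<mu> / 2) / c"
  proof (rule divide_right_mono)
    have "measure_pmf.expectation ?P (\<lambda>S. (1/2) ^ card (S \<inter> K)) \<le> (1 - (1 - 1/2) * (real d / real m)) ^ card K"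
      by (rule uniform_subset_generating_function_le[OF dm K]) auto
    also have "\<dots> \<le> exp (- (real d / real m) / 2) ^ card K"
    proof (rule power_mono)
      show "1 - (1 - 1/2) * (real d / real m) \<le> exp (- (real d / real m) / 2)"
        using exp_ge_add_one_self[of "- (real d / real m) / 2"] by simp
      have "real d / real m \<le> 1" using dm by simp
      from mult_left_mono[OF this, of "1 - 1/2"]
      show "0 \<le> 1 - (1 - 1/2) * (real d / real m)" by simp
    qed
    also have "\<dots> = exp (- \<mu> / 2)" by (simp add: \<mu>_def exp_of_nat_mult[symmetric] mult_ac)
    finally show "measure_pmf.expectation ?P (\<lambda>S. (1/2) ^ card (S \<inter> K)) \<le> exp (- \<mu> / 2)" .
  qed (use c in simp)
  also have "c = exp (- (ln 2 * (\<mu> / 4)))" by (simp add: c_def powr_def ln_div)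
  also have "exp (- \<mu> / 2) / exp (- (ln 2 * (\<mu> / 4))) \<le> exp (- \<mu> / 4)"
  proof -
    have "ln 2 * (\<mu> / 4) \<le> 1 * (\<mu> / 4)" using ln_2_less_1 \<mu>0 by (intro mult_right_mono) auto
    then show ?thesis unfolding exp_diff[symmetric] by simp
  qed
  finally show ?thesis .
qed

lemma uniform_subset_complement:
  assumes "d \<le> m"
  shows "map_pmf (\<lambda>S. {1..m} - S) (pmf_of_set {S. S \<subseteq> {1..m::nat} \<and> card S = d})
    = pmf_of_set {S. S \<subseteq> {1..m} \<and> card S = m - d}"
proof -
  have "(\<lambda>S. {1..m} - S) ` {S. S \<subseteq> {1..m::nat} \<and> card S = d} = {S. S \<subseteq> {1..m} \<and> card S = m - d}"
  proof (intro equalityI subsetI)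
    fix T assume "T \<in> (\<lambda>S. {1..m} - S) ` {S. S \<subseteq> {1..m::nat} \<and> card S = d}"
    then show "T \<in> {S. S \<subseteq> {1..m} \<and> card S = m - d}"
      by (auto simp: card_Diff_subset finite_subset[of _ "{1..m}"])
  next
    fix T assume T: "T \<in> {S. S \<subseteq> {1..m} \<and> card S = m - d}"
    have "T = {1..m} - ({1..m} - T)" using T by auto
    moreover have "card ({1..m} - T) = d"
      using T assms by (auto simp: card_Diff_subset finite_subset[of _ "{1..m}"])
    ultimately show "T \<in> (\<lambda>S. {1..m} - S) ` {S. S \<subseteq> {1..m::nat} \<and> card S = d}" by blast
  qed
  moreover have "inj_on (\<lambda>S. {1..m} - S) {S. S \<subseteq> {1..m::nat} \<and> card S = d}"
    by (rule inj_onI) (metis (no_types, lifting) double_diff mem_Collect_eq order_refl)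
  ultimately show ?thesis
    by (simp only: map_pmf_of_set_inj[OF _ subsets_card_nonempty[OF assms] finite_subsets_card])
qed

definition density_below :: "nat \<Rightarrow> nat set \<Rightarrow> real" where
  "density_below k S = real (card (S \<inter> {1..k})) / real k"

lemma density_below_bounds: "0 \<le> density_below k S" "density_below k S \<le> 1"
proof -
  have "card (S \<inter> {1..k}) \<le> k" using card_mono[of "{1..k}" "S \<inter> {1..k}"] by simp
  then show "0 \<le> density_below k S" "density_below k S \<le> 1"
    by (auto simp: density_below_def divide_le_eq)
qed

text \<open>If \<open>r = card (S \<inter> {1..k})\<close>, then \<open>(r / k) (1 - r / k)\<close> is small only if \<open>r\<close> or \<open>k - r\<close> is far below its
mean. The latter counts the points in \<open>{1..k}\<close> of the complement, which is again a uniformly random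
subset, so the lower tail bound serves both cases.\<close>

lemma uniform_subset_density_variance_small:
  fixes \<epsilon> :: real
  assumes dm: "d \<le> m" "m > 0" and k: "0 < k" "k \<le> m"
    and \<epsilon>: "0 < \<epsilon>" "\<epsilon> \<le> 1" "real d / real m \<le> 1 - \<epsilon>"
  shows "measure_pmf.prob (pmf_of_set {S. S \<subseteq> {1..m} \<and> card S = d})
      {S. density_below k S * (1 - density_below k S) < \<epsilon> * real d / (16 * real m)}
    \<le> 2 * exp (- (\<epsilon> * real d * real k / (4 * real m)))"
proof -
  let ?P = "pmf_of_set {S. S \<subseteq> {1..m} \<and> card S = d}"
  let ?A = "{S. real (card (S \<inter> {1..k})) < real d * real k / real m / 4}"
  let ?A' = "{S. real (card (S \<inter> {1..k})) < real (m - d) * real k / real m / 4}"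
  let ?B = "(\<lambda>S. {1..m} - S) -` ?A'"
  have md: "real (m - d) / real m \<ge> \<epsilon>" using \<epsilon>(3) dm by (simp add: of_nat_diff diff_divide_distrib)
  have d1: "real d / real m \<le> 1" using dm by simp
  have sub: "{S. density_below k S * (1 - density_below k S) < \<epsilon> * real d / (16 * real m)} \<subseteq> ?A \<union> ?B"
  proof
    fix S assume S: "S \<in> {S. density_below k S * (1 - density_below k S) < \<epsilon> * real d / (16 * real m)}"
    show "S \<in> ?A \<union> ?B"
    proof (rule ccontr)
      assume "S \<notin> ?A \<union> ?B"
      then have 1: "real d * real k / real m / 4 \<le> real (card (S \<inter> {1..k}))"
        and 2: "real (m - d) * real k / real m / 4 \<le> real (card (({1..m} - S) \<inter> {1..k}))" by auto
      have "({1..m} - S) \<inter> {1..k} = {1..k} - S \<inter> {1..k}" using k by auto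
      then have "card (({1..m} - S) \<inter> {1..k}) = k - card (S \<inter> {1..k})" by (simp add: card_Diff_subset)
      moreover have "card (S \<inter> {1..k}) \<le> k" using card_mono[of "{1..k}" "S \<inter> {1..k}"] by simp
      ultimately have 3: "real (card (({1..m} - S) \<inter> {1..k})) / real k = 1 - density_below k S"
        using k by (simp add: density_below_def of_nat_diff diff_divide_distrib)
      have "real d / real m / 4 \<le> density_below k S"
        using divide_right_mono[OF 1, of "real k"] k by (simp add: density_below_def)
      moreover have "\<epsilon> / 4 \<le> 1 - density_below k S"
        using divide_right_mono[OF 2, of "real k"] k md unfolding 3 by simp
      ultimately have "real d / real m / 4 * (\<epsilon> / 4) \<le> density_below k S * (1 - density_below k S)"
        using \<epsilon> by (intro mult_mono) (auto simp: density_below_bounds)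
      then show False using S by (simp add: field_simps)
    qed
  qed
  have "measure_pmf.prob ?P {S. density_below k S * (1 - density_below k S) < \<epsilon> * real d / (16 * real m)}
      \<le> measure_pmf.prob ?P (?A \<union> ?B)"
    by (intro measure_pmf.finite_measure_mono sub) auto
  also have "\<dots> \<le> measure_pmf.prob ?P ?A + measure_pmf.prob ?P ?B"
    by (intro measure_Un_le) auto
  also have "measure_pmf.prob ?P ?B = measure_pmf.prob (pmf_of_set {S. S \<subseteq> {1..m} \<and> card S = m - d}) ?A'"
    unfolding uniform_subset_complement[OF dm(1), symmetric] by (rule measure_map_pmf[symmetric])
  also have "\<dots> \<le> exp (- (real (m - d) * real k / real m) / 4)"
    using uniform_subset_lower_tail[of "m - d" m "{1..k}"] dm k by simp
  also have "\<dots> \<le> exp (- (\<epsilon> * real d * real k / (4 * real m)))"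
  proof -
    have "\<epsilon> * (real d / real m) \<le> real (m - d) / real m * 1"
      by (rule mult_mono[OF md d1]) (use \<epsilon> in auto)
    from mult_right_mono[OF this, of "real k"] show ?thesis by simp
  qed
  also have "measure_pmf.prob ?P ?A \<le> exp (- (real d * real k / real m) / 4)"
    using uniform_subset_lower_tail[of d m "{1..k}"] dm k by simp
  also have "\<dots> \<le> exp (- (\<epsilon> * real d * real k / (4 * real m)))"
  proof -
    have "\<epsilon> * (real d * real k / real m) \<le> 1 * (real d * real k / real m)"
      using \<epsilon> by (intro mult_right_mono) auto
    then show ?thesis by simp
  qed
  finally show ?thesis by simp
qed

text \<open>The sum can fall below half of \<open>card V * x\<close> only if about half of the terms fall below \<open>x\<close>, and that is
exponentially unlikely in \<open>L * card V\<close>. A single Markov inequality for \<open>exp (- l * sum)\<close>, with the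
tilt \<open>l = L / x\<close> for which both kinds of terms contribute at most \<open>exp (- L)\<close>, replaces the sum over
the possible sets of small terms.\<close>

lemma sum_of_independent_rarely_small:
  fixes X :: "'b \<Rightarrow> real"
  assumes V: "finite V" and L: "L \<ge> 0" and x: "x > 0" and X: "\<And>s. X s \<ge> 0"
    and fin: "finite (set_pmf P)"
    and small: "measure_pmf.prob P {s. X s < x} \<le> exp (- L)"
  shows "measure_pmf.prob (Pi_pmf V dflt (\<lambda>_. P)) {I. (\<Sum>v\<in>V. X (I v)) < real (card V) * x / 2}
    \<le> (2 * exp (- L / 2)) ^ card V"
proof -
  let ?Q = "Pi_pmf V dflt (\<lambda>_. P)"
  define l where "l = L / x"
  have l: "l \<ge> 0" "l * x = L" using L x by (auto simp: l_def)
  have finQ: "finite (set_pmf ?Q)"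
    by (rule finite_subset[OF set_Pi_pmf_subset'[OF V]]) (auto intro!: finite_PiE_dflt V fin)
  define c where "c = exp (- L / 2) ^ card V"
  have c: "c > 0" by (simp add: c_def)
  let ?Z = "\<lambda>I. \<Prod>v\<in>V. exp (- l * X (I v))"
  have le1: "measure_pmf.prob ?Q {I. (\<Sum>v\<in>V. X (I v)) < real (card V) * x / 2} \<le> measure_pmf.prob ?Q {I. c \<le> ?Z I}"
  proof (intro measure_pmf.finite_measure_mono subsetI CollectI)
    fix I assume "I \<in> {I. (\<Sum>v\<in>V. X (I v)) < real (card V) * x / 2}"
    then have "l * (\<Sum>v\<in>V. X (I v)) \<le> l * (real (card V) * x / 2)"
      using l by (intro mult_left_mono) auto
    also have "\<dots> = real (card V) * (l * x) / 2" by simp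
    finally have "exp (real (card V) * (- L / 2)) \<le> exp (\<Sum>v\<in>V. - l * X (I v))"
      by (simp add: l sum_distrib_left sum_negf)
    then show "c \<le> ?Z I" unfolding c_def exp_of_nat_mult[symmetric] exp_sum[OF V, symmetric] .
  qed auto
  have le2: "measure_pmf.prob ?Q {I. c \<le> ?Z I} \<le> measure_pmf.expectation ?Q ?Z / c"
    by (rule pmf_markov[OF finQ _ c]) (simp add: prod_nonneg)
  have "measure_pmf.expectation ?Q ?Z = (\<Prod>v\<in>V. measure_pmf.expectation P (\<lambda>s. exp (- l * X s)))"
    by (rule expectation_prod_Pi_pmf[OF V]) (auto intro: integrable_measure_pmf_finite fin)
  also have "\<dots> = measure_pmf.expectation P (\<lambda>s. exp (- l * X s)) ^ card V" by simp
  also have "\<dots> \<le> (2 * exp (- L)) ^ card V"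
  proof (rule power_mono)
    have "measure_pmf.expectation P (\<lambda>s. exp (- l * X s))
        \<le> measure_pmf.expectation P (\<lambda>s. indicator {s. X s < x} s + exp (- L))"
    proof (intro integral_mono integrable_measure_pmf_finite fin)
      fix s
      show "exp (- l * X s) \<le> indicator {s. X s < x} s + exp (- L)"
      proof (cases "X s < x")
        case True
        have "exp (- l * X s) \<le> 1" using l X by simp
        then show ?thesis using True by (simp add: add_increasing2)
      next
        case False
        then have "l * x \<le> l * X s" using l by (intro mult_left_mono) auto
        then show ?thesis using False l by simp
      qed
    qed
    also have "\<dots> = measure_pmf.prob P {s. X s < x} + exp (- L)"
      by (subst Bochner_Integration.integral_add) (auto intro: integrable_measure_pmf_finite fin)
    finally show "measure_pmf.expectation P (\<lambda>s. exp (- l * X s)) \<le> 2 * exp (- L)" using small by linarith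
  qed (auto intro: integral_nonneg_AE)
  finally have "measure_pmf.expectation ?Q ?Z / c \<le> (2 * exp (- L)) ^ card V / c"
    by (intro divide_right_mono) (use c in auto)
  note order_trans[OF order_trans[OF le1 le2] this]
  also have "\<dots> = (2 * (exp (- L) / exp (- L / 2))) ^ card V"
    by (simp only: c_def power_divide times_divide_eq_right)
  also have "exp (- L) / exp (- L / 2) = exp (- L / 2)" unfolding exp_diff[symmetric] by simp
  finally show ?thesis .
qed

section \<open>Exposing the edges one at a time\<close>

text \<open>The uniformly random \<open>r\<close>-subset of \<open>{1..s}\<close>, with the elements \<open>s\<close>, \<open>s - 1\<close>, \<open>\<dots>\<close>, \<open>1\<close> decided in this
order. For \<open>r > s\<close> the probability \<open>r / s\<close> exceeds \<open>1\<close> and \<open>bernoulli_pmf\<close> truncates it, so that the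
definition is total and inductions need no side condition on \<open>r\<close>.\<close>

primrec sequential_subset :: "nat \<Rightarrow> nat \<Rightarrow> nat set pmf" where
  "sequential_subset 0 r = return_pmf {}"
| "sequential_subset (Suc s) r = bind_pmf (bernoulli_pmf (real r / real (Suc s)))
     (\<lambda>b. if b then map_pmf (insert (Suc s)) (sequential_subset s (r - 1)) else sequential_subset s r)"

lemma set_sequential_subset: "S \<in> set_pmf (sequential_subset s r) \<Longrightarrow> S \<subseteq> {1..s}"
proof (induction s arbitrary: r S)
  case (Suc s)
  then show ?case by (fastforce split: if_splits)
qed simp

lemma uniform_subset_eq_sequential:
  "r \<le> s \<Longrightarrow> pmf_of_set {S. S \<subseteq> {1..s} \<and> card S = r} = sequential_subset s r"
proof (induction s arbitrary: r)
  case 0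
  have "{S. S \<subseteq> {1..0::nat} \<and> card S = 0} = {{}}" by auto
  then show ?case using 0 by (simp add: pmf_of_set_singleton)
next
  case (Suc s)
  define \<Omega> where "\<Omega> = (\<lambda>s r. {S. S \<subseteq> {1..s::nat} \<and> card S = (r::nat)})"
  have ne: "\<Omega> s r \<noteq> {}" if "r \<le> s" for s r unfolding \<Omega>_def by (rule subsets_card_nonempty[OF that])
  have fin: "finite (\<Omega> s r)" for s r unfolding \<Omega>_def by (rule finite_subsets_card)
  have card: "card (\<Omega> s r) = s choose r" for s r unfolding \<Omega>_def by (rule card_subsets_interval)
  have pmf\<Omega>: "pmf (pmf_of_set (\<Omega> s r)) S = indicator (\<Omega> s r) S / (s choose r)" if "r \<le> s" for s r S
    by (simp add: pmf_of_set[OF ne[OF that] fin] card)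
  have IH: "sequential_subset s r = pmf_of_set (\<Omega> s r)" if "r \<le> s" for r
    using Suc.IH[OF that] by (simp only: \<Omega>_def)
  define p where "p = real r / real (Suc s)"
  have p: "0 \<le> p" "p \<le> 1" using Suc.prems by (auto simp: p_def)
  have "pmf (sequential_subset (Suc s) r) S = pmf (pmf_of_set (\<Omega> (Suc s) r)) S" for S
  proof -
    have step: "pmf (sequential_subset (Suc s) r) S
        = p * pmf (map_pmf (insert (Suc s)) (sequential_subset s (r - 1))) S + (1 - p) * pmf (sequential_subset s r) S"
      unfolding sequential_subset.simps pmf_bind p_def[symmetric] using p by simp
    have taken: "p * pmf (map_pmf (insert (Suc s)) (sequential_subset s (r - 1))) S
        = indicator {S \<in> \<Omega> (Suc s) r. Suc s \<in> S} S / (Suc s choose r)"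
    proof (cases r)
      case 0
      then show ?thesis
        by (auto simp: p_def indicator_def \<Omega>_def card_eq_0_iff finite_subset[of _ "{1..Suc s}"])
    next
      case (Suc r')
      then have r': "r' \<le> s" using Suc.prems by simp
      have inj: "inj_on (insert (Suc s)) (\<Omega> s r')"
        by (rule inj_onI) (metis (no_types, lifting) \<Omega>_def atLeastAtMost_iff insert_ident mem_Collect_eq not_less_eq_eq order_refl subsetD)
      have img: "insert (Suc s) ` \<Omega> s r' = {S \<in> \<Omega> (Suc s) r. Suc s \<in> S}"
      proof (intro equalityI subsetI)
        fix T assume "T \<in> insert (Suc s) ` \<Omega> s r'"
        then obtain U where U: "T = insert (Suc s) U" "U \<subseteq> {1..s}" "card U = r'" by (auto simp: \<Omega>_def)
        then have "Suc s \<notin> U" "finite U" using finite_subset by auto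
        then show "T \<in> {S \<in> \<Omega> (Suc s) r. Suc s \<in> S}" using U Suc by (auto simp: \<Omega>_def)
      next
        fix T assume T: "T \<in> {S \<in> \<Omega> (Suc s) r. Suc s \<in> S}"
        then have "finite T" using finite_subset[of T "{1..Suc s}"] by (auto simp: \<Omega>_def)
        then have "T - {Suc s} \<in> \<Omega> s r'" using T Suc by (auto simp: \<Omega>_def le_Suc_eq)
        moreover have "T = insert (Suc s) (T - {Suc s})" using T by auto
        ultimately show "T \<in> insert (Suc s) ` \<Omega> s r'" by blast
      qed
      have "map_pmf (insert (Suc s)) (sequential_subset s (r - 1)) = pmf_of_set {S \<in> \<Omega> (Suc s) r. Suc s \<in> S}"
        using map_pmf_of_set_inj[OF inj ne[OF r'] fin] Suc IH[OF r'] img by simp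
      moreover have "card {S \<in> \<Omega> (Suc s) r. Suc s \<in> S} = s choose r'"
        using card_image[OF inj] by (simp add: img card)
      moreover have "{S \<in> \<Omega> (Suc s) r. Suc s \<in> S} \<noteq> {}" "finite {S \<in> \<Omega> (Suc s) r. Suc s \<in> S}"
        using ne[OF r'] fin unfolding img[symmetric] by auto
      ultimately have "pmf (map_pmf (insert (Suc s)) (sequential_subset s (r - 1))) S
          = indicator {S \<in> \<Omega> (Suc s) r. Suc s \<in> S} S / (s choose r')"
        by (simp add: pmf_of_set)
      moreover have "real (s choose r') = p * (Suc s choose r)"
      proof -
        have "real (Suc r' * (Suc s choose Suc r')) = real (Suc s * (s choose r'))"
          using Suc_times_binomial_eq[of s r'] by (simp only: mult.commute)
        then show ?thesis unfolding p_def Suc by (simp only: of_nat_mult) (simp add: field_simps)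
      qed
      moreover have "p \<noteq> 0" using Suc by (simp add: p_def)
      ultimately show ?thesis by simp
    qed
    have skipped: "(1 - p) * pmf (sequential_subset s r) S
        = indicator {S \<in> \<Omega> (Suc s) r. Suc s \<notin> S} S / (Suc s choose r)"
    proof (cases "r \<le> s")
      case True
      have eq: "{S \<in> \<Omega> (Suc s) r. Suc s \<notin> S} = \<Omega> s r"
        by (auto simp: \<Omega>_def le_Suc_eq)
      have "real ((Suc s - r) * (Suc s choose r)) = real (Suc s * (s choose r))"
        using binomial_absorb_comp[of "Suc s" r] by simp
      have "real (Suc s) * (1 - p) * (Suc s choose r) = real (Suc s) * (s choose r)"
      proof -
        have "real (Suc s) * (1 - p) = real (Suc s - r)" using True by (simp add: p_def of_nat_diff field_simps)
        then show ?thesis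
          using \<open>real ((Suc s - r) * (Suc s choose r)) = real (Suc s * (s choose r))\<close> by (simp only: of_nat_mult)
      qed
      then have b: "real (s choose r) = (1 - p) * (Suc s choose r)"
        by (metis mult.assoc mult_left_cancel of_nat_eq_0_iff old.nat.distinct(2))
      have "p < 1" using True by (simp add: p_def)
      then show ?thesis unfolding eq IH[OF True] pmf\<Omega>[OF True] b by simp
    next
      case False
      then have r: "r = Suc s" using Suc.prems by simp
      have "S = {1..Suc s}" if "S \<in> \<Omega> (Suc s) r"
        using that card_subset_eq[of "{1..Suc s}" S] by (auto simp: \<Omega>_def r)
      then have "indicator {S \<in> \<Omega> (Suc s) r. Suc s \<notin> S} S = (0::real)" by (auto simp: indicator_def)
      then show ?thesis by (simp add: p_def r)
    qed
    show ?thesis unfolding step taken skipped pmf\<Omega>[OF Suc.prems]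
      by (simp add: indicator_def)
  qed
  then have "sequential_subset (Suc s) r = pmf_of_set (\<Omega> (Suc s) r)" by (rule pmf_eqI)
  then show ?case by (simp only: \<Omega>_def)
qed

lemma prob_bind_le:
  assumes c: "c \<ge> 0"
    and le: "\<And>x. x \<in> set_pmf p \<Longrightarrow> x \<in> A \<Longrightarrow> measure_pmf.prob (q x) E \<le> c"
    and null: "\<And>x. x \<in> set_pmf p \<Longrightarrow> x \<notin> A \<Longrightarrow> measure_pmf.prob (q x) E = 0"
  shows "measure_pmf.prob (bind_pmf p q) E \<le> c * measure_pmf.prob p A"
proof -
  have "emeasure (bind_pmf p q) E = (\<integral>\<^sup>+x. emeasure (q x) E \<partial>p)" by simp
  also have "\<dots> \<le> (\<integral>\<^sup>+x. ennreal c * indicator A x \<partial>p)"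
  proof (rule nn_integral_mono_AE, rule AE_pmfI)
    fix x assume x: "x \<in> set_pmf p"
    show "emeasure (q x) E \<le> ennreal c * indicator A x"
      using le[OF x] null[OF x] by (cases "x \<in> A") (auto simp: measure_pmf.emeasure_eq_measure ennreal_leI)
  qed
  also have "\<dots> = ennreal c * emeasure p A" by (simp add: nn_integral_cmult_indicator)
  finally show ?thesis
    using c by (simp add: measure_pmf.emeasure_eq_measure ennreal_mult'[symmetric])
qed

text \<open>If vertex \<open>v\<close> has \<open>r v\<close> incidences left to place among the edges \<open>{1..k}\<close>, it joins edge \<open>k\<close> with
probability \<open>r v / k\<close>. This is the conditional variance of the number of vertices in edge \<open>k\<close>, and
also of \<open>\<psi>(e\<^sub>k)\<close> for every colouring \<open>\<psi>\<close>.\<close>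

definition exposure_variance :: "'a set \<Rightarrow> nat \<Rightarrow> ('a \<Rightarrow> nat) \<Rightarrow> real" where
  "exposure_variance V k r = (\<Sum>v\<in>V. real (r v) / real k * (1 - real (r v) / real k))"

text \<open>Here \<open>I v \<inter> {k<..s}\<close> is what has been exposed before edge \<open>k\<close>. Counting the remaining incidences as
\<open>r v - card (I v \<inter> {k<..s})\<close>, and not as \<open>card (I v \<inter> {1..k})\<close>, makes the event a function of the
history, which is what the induction over \<open>s\<close> requires.\<close>

definition exposure_event ::
  "'a set \<Rightarrow> ('a \<Rightarrow> int) \<Rightarrow> real \<Rightarrow> real \<Rightarrow> nat \<Rightarrow> nat \<Rightarrow> ('a \<Rightarrow> nat) \<Rightarrow> ('a \<Rightarrow> nat set) \<Rightarrow> bool" where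
  "exposure_event V \<psi> t W l s r I \<longleftrightarrow> (\<forall>k\<in>{l<..s}. \<bar>real_of_int (edge_sum \<psi> {v\<in>V. k \<in> I v})\<bar> < t
      \<and> W \<le> exposure_variance V k (\<lambda>v. r v - card (I v \<inter> {k<..s})))"

lemma bernoulli_pmf_min: "bernoulli_pmf (min 1 x) = bernoulli_pmf x"
  by (rule pmf_eqI) (simp add: bernoulli_pmf.rep_eq min_def max_def)

text \<open>Each edge \<open>k > l\<close> contributes a factor \<open>\<beta>\<close>: if the conditional variance is below \<open>W\<close>, the event
fails at once; otherwise, given the history, the edge satisfies \<open>\<bar>\<psi>(e\<^sub>k)\<bar> < t\<close> with probability at most \<open>\<beta>\<close>.
The induction exposes edge \<open>s + 1\<close>, that is, the first bit of every \<open>I v\<close> simultaneously; \<open>f\<close> records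
which vertices join it and \<open>glue f J\<close> puts this bit back on top of the remaining choices \<open>J\<close>.\<close>

lemma sequential_exposure_bound:
  fixes \<psi> :: "'a \<Rightarrow> int"
  assumes V: "finite V" and \<beta>: "0 \<le> \<beta>"
    and step: "\<And>p. (\<And>v. v \<in> V \<Longrightarrow> 0 \<le> p v \<and> p v \<le> 1) \<Longrightarrow> W \<le> (\<Sum>v\<in>V. p v * (1 - p v)) \<Longrightarrow>
      measure_pmf.prob (Pi_pmf V False (\<lambda>v. bernoulli_pmf (p v)))
        {f. \<bar>real_of_int (edge_sum \<psi> {v\<in>V. f v})\<bar> < t} \<le> \<beta>"
  shows "measure_pmf.prob (Pi_pmf V {} (\<lambda>v. sequential_subset s (r v))) {I. exposure_event V \<psi> t W l s r I} \<le> \<beta> ^ (s - l)"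
proof (induction s arbitrary: r)
  case 0
  then show ?case by simp
next
  case (Suc s)
  show ?case
  proof (cases "l \<le> s")
    case False
    then show ?thesis by simp
  next
    case True
    define p where "p = (\<lambda>v. min 1 (real (r v) / real (Suc s)))"
    let ?B = "Pi_pmf V False (\<lambda>v. bernoulli_pmf (p v))"
    define r' where "r' = (\<lambda>f v. r v - (of_bool (f v) :: nat))"
    define glue where "glue = (\<lambda>f (J :: 'a \<Rightarrow> nat set) v. if v \<in> V then (if f v then insert (Suc s) (J v) else J v) else {})"
    let ?Q = "\<lambda>f. Pi_pmf V {} (\<lambda>v. sequential_subset s (r' f v))"
    have "Pi_pmf V {} (\<lambda>v. sequential_subset (Suc s) (r v)) = bind_pmf ?B (\<lambda>f. Pi_pmf V {}
        (\<lambda>v. if f v then map_pmf (insert (Suc s)) (sequential_subset s (r v - 1)) else sequential_subset s (r v)))"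
      unfolding sequential_subset.simps p_def bernoulli_pmf_min by (rule Pi_pmf_bind[OF V])
    also have "\<dots> = bind_pmf ?B (\<lambda>f. map_pmf (glue f) (?Q f))"
    proof (rule arg_cong[of _ _ "bind_pmf ?B"], rule ext)
      fix f :: "'a \<Rightarrow> bool"
      have "Pi_pmf V {} (\<lambda>v. if f v then map_pmf (insert (Suc s)) (sequential_subset s (r v - 1)) else sequential_subset s (r v))
          = Pi_pmf V {} (\<lambda>v. bind_pmf (sequential_subset s (r' f v)) (\<lambda>S. return_pmf (if f v then insert (Suc s) S else S)))"
        by (rule Pi_pmf_cong) (auto simp: r'_def map_pmf_def bind_return_pmf')
      also have "\<dots> = map_pmf (glue f) (?Q f)"
        by (subst Pi_pmf_bind[OF V, where d'="{}"]) (simp add: V map_pmf_def glue_def)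
      finally show "Pi_pmf V {} (\<lambda>v. if f v then map_pmf (insert (Suc s)) (sequential_subset s (r v - 1)) else sequential_subset s (r v))
          = map_pmf (glue f) (?Q f)" .
    qed
    finally have decomp: "Pi_pmf V {} (\<lambda>v. sequential_subset (Suc s) (r v)) = bind_pmf ?B (\<lambda>f. map_pmf (glue f) (?Q f))" .
    define A where "A = {f. \<bar>real_of_int (edge_sum \<psi> {v\<in>V. f v})\<bar> < t \<and> W \<le> exposure_variance V (Suc s) r}"
    have glue_event: "f \<in> A \<and> exposure_event V \<psi> t W l s (r' f) J"
      if J: "J \<in> set_pmf (?Q f)" and ev: "exposure_event V \<psi> t W l (Suc s) r (glue f J)" for f J
    proof
      have sub: "J v \<subseteq> {1..s}" if "v \<in> V" for v
        using J that set_sequential_subset unfolding set_Pi_pmf[OF V] PiE_dflt_def by fastforce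
      have mem: "k \<in> glue f J v \<longleftrightarrow> (if k = Suc s then f v else k \<in> J v)" if "v \<in> V" "k \<le> Suc s" for v k
        using sub[OF that(1)] that by (auto simp: glue_def)
      have "{v\<in>V. Suc s \<in> glue f J v} = {v\<in>V. f v}" using mem by auto
      moreover from True have "Suc s \<in> {l<..Suc s}" by simp
      then have "\<bar>real_of_int (edge_sum \<psi> {v\<in>V. Suc s \<in> glue f J v})\<bar> < t
          \<and> W \<le> exposure_variance V (Suc s) (\<lambda>v. r v - card (glue f J v \<inter> {Suc s<..Suc s}))"
        using ev unfolding exposure_event_def by blast
      ultimately show "f \<in> A" unfolding A_def by simp
      show "exposure_event V \<psi> t W l s (r' f) J"
        unfolding exposure_event_def
      proof
        fix k assume k: "k \<in> {l<..s}"
        have 1: "{v\<in>V. k \<in> glue f J v} = {v\<in>V. k \<in> J v}" using mem k by auto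
        have 2: "r v - card (glue f J v \<inter> {k<..Suc s}) = r' f v - card (J v \<inter> {k<..s})" if "v \<in> V" for v
        proof -
          have "glue f J v \<inter> {k<..Suc s} = (if f v then insert (Suc s) (J v \<inter> {k<..s}) else J v \<inter> {k<..s})"
            using sub[OF that] that k by (auto simp: glue_def le_Suc_eq)
          then show ?thesis by (simp add: r'_def)
        qed
        have 3: "exposure_variance V k (\<lambda>v. r v - card (glue f J v \<inter> {k<..Suc s}))
            = exposure_variance V k (\<lambda>v. r' f v - card (J v \<inter> {k<..s}))"
          unfolding exposure_variance_def by (intro sum.cong refl) (simp only: 2)
        from k have "k \<in> {l<..Suc s}" by simp
        then have "\<bar>real_of_int (edge_sum \<psi> {v\<in>V. k \<in> glue f J v})\<bar> < t
            \<and> W \<le> exposure_variance V k (\<lambda>v. r v - card (glue f J v \<inter> {k<..Suc s}))"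
          using ev unfolding exposure_event_def by blast
        then show "\<bar>real_of_int (edge_sum \<psi> {v\<in>V. k \<in> J v})\<bar> < t
            \<and> W \<le> exposure_variance V k (\<lambda>v. r' f v - card (J v \<inter> {k<..s}))"
          unfolding 1 3 .
      qed
    qed
    have "measure_pmf.prob (Pi_pmf V {} (\<lambda>v. sequential_subset (Suc s) (r v))) {I. exposure_event V \<psi> t W l (Suc s) r I}
        \<le> \<beta> ^ (s - l) * measure_pmf.prob ?B A"
      unfolding decomp
    proof (rule prob_bind_le)
      fix f
      have le: "measure_pmf.prob (map_pmf (glue f) (?Q f)) {I. exposure_event V \<psi> t W l (Suc s) r I}
        \<le> measure_pmf.prob (?Q f) {J. f \<in> A \<and> exposure_event V \<psi> t W l s (r' f) J}"
        unfolding measure_map_pmf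
        by (rule measure_pmf.finite_measure_mono_AE) (auto intro!: AE_pmfI dest: glue_event)
      show "measure_pmf.prob (map_pmf (glue f) (?Q f)) {I. exposure_event V \<psi> t W l (Suc s) r I} \<le> \<beta> ^ (s - l)"
        if "f \<in> A"
        using order_trans[OF le] Suc.IH[of "r' f"] that by simp
      show "measure_pmf.prob (map_pmf (glue f) (?Q f)) {I. exposure_event V \<psi> t W l (Suc s) r I} = 0"
        if "f \<notin> A"
        using le that by (simp add: measure_le_0_iff)
    qed (use \<beta> in simp)
    moreover have "measure_pmf.prob ?B A \<le> \<beta>"
    proof (cases "W \<le> exposure_variance V (Suc s) r")
      case False
      then have "A = {}" by (auto simp: A_def)
      then show ?thesis using \<beta> by simp
    next
      case True
      have "exposure_variance V (Suc s) r \<le> (\<Sum>v\<in>V. p v * (1 - p v))"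
        unfolding exposure_variance_def
      proof (rule sum_mono)
        fix v
        show "real (r v) / real (Suc s) * (1 - real (r v) / real (Suc s)) \<le> p v * (1 - p v)"
        proof (cases "real (r v) / real (Suc s) \<le> 1")
          case True
          then show ?thesis by (simp add: p_def min_def)
        next
          case False
          then have "real (r v) / real (Suc s) * (1 - real (r v) / real (Suc s)) \<le> 0"
            by (intro mult_nonneg_nonpos) auto
          then show ?thesis using False by (simp add: p_def min_def)
        qed
      qed
      then have "measure_pmf.prob ?B {f. \<bar>real_of_int (edge_sum \<psi> {v\<in>V. f v})\<bar> < t} \<le> \<beta>"
        using True by (intro step) (auto simp: p_def)
      then show ?thesis using True by (simp add: A_def)
    qed
    then have "\<beta> ^ (s - l) * measure_pmf.prob ?B A \<le> \<beta> ^ (s - l) * \<beta>"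
      using \<beta> by (intro mult_left_mono) auto
    moreover have "\<beta> ^ (s - l) * \<beta> = \<beta> ^ (Suc s - l)" using True by (simp add: Suc_diff_le)
    ultimately show ?thesis by (simp only: order_trans)
  qed
qed

section \<open>The union bound over colourings\<close>

lemma disc_less_witness:
  assumes m: "m > 0" and small: "real_of_int (disc (incidence_hypergraph n m I)) < t"
  obtains \<psi> where "\<psi> \<in> {1..n} \<rightarrow>\<^sub>E {-1, 1}"
    "\<And>k. k \<in> {1..m} \<Longrightarrow> \<bar>real_of_int (edge_sum \<psi> {u\<in>{1..n}. k \<in> I u})\<bar> < t"
proof -
  let ?H = "incidence_hypergraph n m I"
  have col: "colourings ?H = {1..n} \<rightarrow>\<^sub>E {-1, 1}" by (simp add: colourings_def incidence_hypergraph_def)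
  have edges: "set_mset (edges ?H) = (\<lambda>i. {u\<in>{1..n}. i \<in> I u}) ` {1..m}"
    by (simp add: incidence_hypergraph_def)
  have "finite (colourings ?H)" unfolding col by (intro finite_PiE) auto
  moreover have "colourings ?H \<noteq> {}" unfolding col by (simp add: PiE_eq_empty_iff)
  ultimately have "disc ?H \<in> colouring_disc ?H ` colourings ?H"
    unfolding disc_def by (intro Min_in) auto
  then obtain \<psi> where \<psi>: "\<psi> \<in> colourings ?H" "disc ?H = colouring_disc ?H \<psi>" by blast
  have "\<bar>real_of_int (edge_sum \<psi> {u\<in>{1..n}. k \<in> I u})\<bar> < t" if "k \<in> {1..m}" for k
  proof -
    have "\<bar>edge_sum \<psi> {u\<in>{1..n}. k \<in> I u}\<bar> \<le> colouring_disc ?H \<psi>"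
      unfolding colouring_disc_def edges by (intro Max_ge) (use that in auto)
    then show ?thesis using small \<psi>(2) by linarith
  qed
  then show thesis using \<psi>(1) that unfolding col by blast
qed

text \<open>The events in the hypothesis on the variances do not depend on the colouring. They enter once, and only
the product of the conditional probabilities is multiplied by the number \<open>2 ^ n\<close> of colourings.
The edges \<open>1, \<dots>, l\<close>, exposed last, are given away.\<close>

lemma disc_prob_union_bound:
  fixes t W \<beta> :: real
  defines "P \<equiv> (\<lambda>m d. pmf_of_set {S. S \<subseteq> {1..m::nat} \<and> card S = (d::nat)})"
  assumes dm: "d \<le> m" "m > 0" and \<beta>: "0 \<le> \<beta>"
    and step: "\<And>p \<psi>. (\<And>v. v \<in> {1..n} \<Longrightarrow> 0 \<le> p v \<and> p v \<le> 1) \<Longrightarrow> (\<And>v. v \<in> {1..n} \<Longrightarrow> \<psi> v \<in> {-1, 1}) \<Longrightarrow>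
      W \<le> (\<Sum>v\<in>{1..n}. p v * (1 - p v)) \<Longrightarrow>
      measure_pmf.prob (Pi_pmf {1..n} False (\<lambda>v. bernoulli_pmf (p v)))
        {f. \<bar>real_of_int (edge_sum \<psi> {v\<in>{1..n}. f v})\<bar> < t} \<le> \<beta>"
    and variance: "\<And>k. k \<in> {l<..m} \<Longrightarrow> measure_pmf.prob (Pi_pmf {1..n} {} (\<lambda>_. P m d))
        {I. (\<Sum>v\<in>{1..n}. density_below k (I v) * (1 - density_below k (I v))) < W} \<le> \<delta>"
    and \<delta>: "0 \<le> \<delta>"
  shows "measure_pmf.prob (edge_dependent_model n m d) {H. real_of_int (disc H) < t}
    \<le> real m * \<delta> + 2 ^ n * \<beta> ^ (m - l)"
proof -
  let ?M = "Pi_pmf {1..n} {} (\<lambda>_. P m d)"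
  let ?C = "{1..n} \<rightarrow>\<^sub>E {-1, 1::int}"
  define Bad where "Bad = (\<lambda>k. {I. (\<Sum>v\<in>{1..n}. density_below k (I v) * (1 - density_below k (I v))) < W})"
  define Ev where "Ev = (\<lambda>\<psi>. {I. exposure_event {1..n} \<psi> t W l m (\<lambda>_. d) I})"
  have finC: "finite ?C" by (intro finite_PiE) auto
  have cardC: "card ?C = 2 ^ n" by (simp add: card_PiE numeral_2_eq_2)
  have seq: "P m d = sequential_subset m d" unfolding P_def by (rule uniform_subset_eq_sequential[OF dm(1)])
  have supp: "I v \<subseteq> {1..m}" "card (I v) = d" if "I \<in> set_pmf ?M" "v \<in> {1..n}" for I v
  proof -
    have "I v \<in> set_pmf (P m d)" using that by (auto simp: set_Pi_pmf PiE_dflt_def)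
    then show "I v \<subseteq> {1..m}" "card (I v) = d"
      unfolding P_def set_pmf_of_set[OF subsets_card_nonempty[OF dm(1)] finite_subsets_card] by auto
  qed
  have "measure_pmf.prob (edge_dependent_model n m d) {H. real_of_int (disc H) < t}
      = measure_pmf.prob ?M {I. real_of_int (disc (incidence_hypergraph n m I)) < t}"
    by (simp add: edge_dependent_model_def P_def vimage_def)
  also have "\<dots> \<le> measure_pmf.prob ?M ((\<Union>k\<in>{l<..m}. Bad k) \<union> (\<Union>\<psi>\<in>?C. Ev \<psi>))"
  proof (rule measure_pmf.finite_measure_mono_AE, rule AE_pmfI, rule impI)
    fix I assume I: "I \<in> set_pmf ?M" and "I \<in> {I. real_of_int (disc (incidence_hypergraph n m I)) < t}"
    then obtain \<psi> where \<psi>: "\<psi> \<in> ?C"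
      and e: "\<And>k. k \<in> {1..m} \<Longrightarrow> \<bar>real_of_int (edge_sum \<psi> {u\<in>{1..n}. k \<in> I u})\<bar> < t"
      using disc_less_witness[OF dm(2)] by blast
    have var: "exposure_variance {1..n} k (\<lambda>v. d - card (I v \<inter> {k<..m}))
        = (\<Sum>v\<in>{1..n}. density_below k (I v) * (1 - density_below k (I v)))" if "k \<in> {l<..m}" for k
      unfolding exposure_variance_def density_below_def
    proof (intro sum.cong refl)
      fix v assume v: "v \<in> {1..n}"
      have fin: "finite (I v)" using supp(1)[OF I v] finite_subset by blast
      have "I v = (I v \<inter> {1..k}) \<union> (I v \<inter> {k<..m})" using supp(1)[OF I v] that by force
      then have "card (I v) = card (I v \<inter> {1..k}) + card (I v \<inter> {k<..m})"
        using fin by (subst card_Un_disjoint[symmetric]) auto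
      then have "d - card (I v \<inter> {k<..m}) = card (I v \<inter> {1..k})" using supp(2)[OF I v] by simp
      then show "real (d - card (I v \<inter> {k<..m})) / real k * (1 - real (d - card (I v \<inter> {k<..m})) / real k)
        = real (card (I v \<inter> {1..k})) / real k * (1 - real (card (I v \<inter> {1..k})) / real k)" by simp
    qed
    show "I \<in> (\<Union>k\<in>{l<..m}. Bad k) \<union> (\<Union>\<psi>\<in>?C. Ev \<psi>)"
    proof (cases "I \<in> (\<Union>k\<in>{l<..m}. Bad k)")
      case False
      have "I \<in> Ev \<psi>"
        unfolding Ev_def exposure_event_def
      proof (intro CollectI ballI conjI)
        fix k assume k: "k \<in> {l<..m}"
        then show "\<bar>real_of_int (edge_sum \<psi> {v\<in>{1..n}. k \<in> I v})\<bar> < t" by (intro e) auto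
        show "W \<le> exposure_variance {1..n} k (\<lambda>v. d - card (I v \<inter> {k<..m}))"
          using False k unfolding var[OF k] Bad_def by (auto simp: not_less)
      qed
      then show ?thesis using \<psi> by blast
    qed blast
  qed simp
  also have "\<dots> \<le> measure_pmf.prob ?M (\<Union>k\<in>{l<..m}. Bad k) + measure_pmf.prob ?M (\<Union>\<psi>\<in>?C. Ev \<psi>)"
    by (intro measure_Un_le) auto
  also have "\<dots> \<le> (\<Sum>k\<in>{l<..m}. measure_pmf.prob ?M (Bad k)) + (\<Sum>\<psi>\<in>?C. measure_pmf.prob ?M (Ev \<psi>))"
    using finC by (intro add_mono measure_pmf.finite_measure_subadditive_finite) auto
  also have "\<dots> \<le> (\<Sum>k\<in>{l<..m}. \<delta>) + (\<Sum>\<psi>\<in>?C. \<beta> ^ (m - l))"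
  proof (intro add_mono sum_mono)
    show "measure_pmf.prob ?M (Bad k) \<le> \<delta>" if "k \<in> {l<..m}" for k
      using variance[OF that] by (simp only: Bad_def)
    show "measure_pmf.prob ?M (Ev \<psi>) \<le> \<beta> ^ (m - l)" if "\<psi> \<in> ?C" for \<psi>
      unfolding seq Ev_def
      by (rule sequential_exposure_bound[OF finite_atLeastAtMost \<beta> step]) (use that in \<open>auto dest: PiE_mem\<close>)
  qed
  also have "\<dots> = real (m - l) * \<delta> + 2 ^ n * \<beta> ^ (m - l)"
    by (simp only: sum_constant cardC card_greaterThanAtMost of_nat_power of_nat_numeral)
  also have "\<dots> \<le> real m * \<delta> + 2 ^ n * \<beta> ^ (m - l)" using \<delta> by (intro add_right_mono mult_right_mono) auto
  finally show ?thesis .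
qed

text \<open>With all incidences placed, the remaining number for \<open>v\<close> at edge \<open>k\<close> is \<open>card (I v \<inter> {1..k})\<close>, which
is independent for different vertices. The unit added to \<open>L\<close> absorbs the factor \<open>2\<close> in the tail bound
for a single vertex.\<close>

lemma exposure_variance_small_prob:
  fixes \<epsilon> L :: real
  assumes dm: "0 < d" "d \<le> m" "m > 0" and k: "0 < k" "k \<le> m"
    and \<epsilon>: "0 < \<epsilon>" "\<epsilon> \<le> 1" "real d / real m \<le> 1 - \<epsilon>"
    and L: "0 \<le> L" "L + 1 \<le> \<epsilon> * real d * real k / (4 * real m)"
  shows "measure_pmf.prob (Pi_pmf {1..n} {} (\<lambda>_. pmf_of_set {S. S \<subseteq> {1..m::nat} \<and> card S = d}))
      {I. (\<Sum>v\<in>{1..n}. density_below k (I v) * (1 - density_below k (I v))) < \<epsilon> * real d * real n / (32 * real m)}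
    \<le> (2 * exp (- L / 2)) ^ n"
proof -
  let ?P = "pmf_of_set {S. S \<subseteq> {1..m::nat} \<and> card S = d}"
  define x where "x = \<epsilon> * real d / (16 * real m)"
  have x: "x > 0" using dm \<epsilon> by (simp add: x_def)
  have "measure_pmf.prob ?P {S. density_below k S * (1 - density_below k S) < x}
      \<le> 2 * exp (- (\<epsilon> * real d * real k / (4 * real m)))"
    unfolding x_def by (rule uniform_subset_density_variance_small[OF dm(2,3) k \<epsilon>])
  also have "\<dots> \<le> exp 1 * exp (- (L + 1))"
    using L exp_ge_add_one_self[of 1] by (intro mult_mono) auto
  also have "\<dots> = exp (- L)" by (simp add: exp_add[symmetric])
  finally have small: "measure_pmf.prob ?P {S. density_below k S * (1 - density_below k S) < x} \<le> exp (- L)" .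
  have eq: "real (card {1..n}) * x / 2 = \<epsilon> * real d * real n / (32 * real m)" by (simp add: x_def)
  have "measure_pmf.prob (Pi_pmf {1..n} {} (\<lambda>_. ?P))
      {I. (\<Sum>v\<in>{1..n}. density_below k (I v) * (1 - density_below k (I v))) < real (card {1..n}) * x / 2}
    \<le> (2 * exp (- L / 2)) ^ card {1..n}"
    by (rule sum_of_independent_rarely_small[OF _ L(1) x _ finite_set_uniform_subset[OF dm(2)] small])
       (auto simp: density_below_bounds)
  then show ?thesis unfolding eq by simp
qed

text \<open>Whatever the other vertices choose, at most one choice of \<open>I 1\<close> makes all the edge sizes even.\<close>

lemma all_edges_even_prob:
  fixes n :: nat
  assumes n: "n > 0" and dm: "d \<le> m"
  shows "measure_pmf.prob (Pi_pmf {1..n} {} (\<lambda>_. pmf_of_set {S. S \<subseteq> {1..m::nat} \<and> card S = d}))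
    {I. \<forall>k\<in>{1..m}. even (card {u\<in>{1..n}. k \<in> I u})} \<le> 1 / real (m choose d)"
proof -
  let ?P = "pmf_of_set {S. S \<subseteq> {1..m::nat} \<and> card S = d}"
  let ?E = "{I. \<forall>k\<in>{1..m}. even (card {u\<in>{1..n}. k \<in> I u})}"
  have V: "{1..n} = insert 1 {2..n}" using n by auto
  have "Pi_pmf {1..n} {} (\<lambda>_. ?P) = bind_pmf ?P (\<lambda>y. bind_pmf (Pi_pmf {2..n} {} (\<lambda>_. ?P)) (\<lambda>f. return_pmf (f(1 := y))))"
    unfolding V by (rule Pi_pmf_insert') auto
  also have "\<dots> = bind_pmf (Pi_pmf {2..n} {} (\<lambda>_. ?P)) (\<lambda>f. map_pmf (\<lambda>y. f(1 := y)) ?P)"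
    unfolding map_pmf_def by (rule bind_commute_pmf)
  finally have decomp: "Pi_pmf {1..n} {} (\<lambda>_. ?P) = bind_pmf (Pi_pmf {2..n} {} (\<lambda>_. ?P)) (\<lambda>f. map_pmf (\<lambda>y. f(1 := y)) ?P)" .
  have "measure_pmf.prob (map_pmf (\<lambda>y. f(1 := y)) ?P) ?E \<le> 1 / real (m choose d)" for f
  proof -
    define T where "T = {k\<in>{1..m}. odd (card {u\<in>{2..n}. k \<in> f u})}"
    have "y = T" if y: "y \<in> set_pmf ?P" "f(1 := y) \<in> ?E" for y
    proof -
      have ym: "y \<subseteq> {1..m}"
        using y(1) unfolding set_pmf_of_set[OF subsets_card_nonempty[OF dm] finite_subsets_card] by auto
      have "k \<in> y \<longleftrightarrow> k \<in> T" if k: "k \<in> {1..m}" for k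
      proof -
        have "{u\<in>{1..n}. k \<in> (f(1 := y)) u} = (if k \<in> y then {1} else {}) \<union> {u\<in>{2..n}. k \<in> f u}"
          unfolding V by auto
        then have "card {u\<in>{1..n}. k \<in> (f(1 := y)) u} = of_bool (k \<in> y) + card {u\<in>{2..n}. k \<in> f u}"
          by simp
        moreover have "even (card {u\<in>{1..n}. k \<in> (f(1 := y)) u})" using y(2) k by blast
        ultimately have "even (of_bool (k \<in> y) + card {u\<in>{2..n}. k \<in> f u})" by simp
        then show ?thesis using k by (cases "k \<in> y") (simp_all add: T_def)
      qed
      then show ?thesis using ym by (auto simp: T_def)
    qed
    then have "measure_pmf.prob (map_pmf (\<lambda>y. f(1 := y)) ?P) ?E \<le> measure_pmf.prob ?P {T}"
      unfolding measure_map_pmf by (intro measure_pmf.finite_measure_mono_AE AE_pmfI) auto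
    also have "\<dots> \<le> 1 / real (m choose d)"
      unfolding measure_pmf_single pmf_of_set[OF subsets_card_nonempty[OF dm] finite_subsets_card] card_subsets_interval
      by (intro divide_right_mono) (auto simp: indicator_def)
    finally show ?thesis .
  qed
  then have "measure_pmf.prob (Pi_pmf {1..n} {} (\<lambda>_. ?P)) ?E
      \<le> 1 / real (m choose d) * measure_pmf.prob (Pi_pmf {2..n} {} (\<lambda>_. ?P)) UNIV"
    unfolding decomp by (intro prob_bind_le) auto
  then show ?thesis by simp
qed

text \<open>A colouring sum over an edge has the parity of the size of the edge, so discrepancy \<open>0\<close> requires every
edge to have even size.\<close>

lemma disc_less_one_prob:
  fixes \<epsilon> :: real
  assumes n: "n > 0" and dm: "0 < d" "d \<le> m" and \<epsilon>: "real d / real m \<le> 1 - \<epsilon>"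
  shows "measure_pmf.prob (edge_dependent_model n m d) {H. real_of_int (disc H) < 1} \<le> (1 - \<epsilon>) ^ d"
proof -
  let ?M = "Pi_pmf {1..n} {} (\<lambda>_. pmf_of_set {S. S \<subseteq> {1..m::nat} \<and> card S = d})"
  have "measure_pmf.prob (edge_dependent_model n m d) {H. real_of_int (disc H) < 1}
      = measure_pmf.prob ?M {I. real_of_int (disc (incidence_hypergraph n m I)) < 1}"
    by (simp add: edge_dependent_model_def vimage_def)
  also have "\<dots> \<le> measure_pmf.prob ?M {I. \<forall>k\<in>{1..m}. even (card {u\<in>{1..n}. k \<in> I u})}"
  proof (intro measure_pmf.finite_measure_mono subsetI CollectI ballI)
    fix I k assume I: "I \<in> {I. real_of_int (disc (incidence_hypergraph n m I)) < 1}" and k: "k \<in> {1..m}"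
    from I k obtain \<psi> where \<psi>: "\<psi> \<in> {1..n} \<rightarrow>\<^sub>E {-1, 1}"
      and lt: "\<bar>real_of_int (edge_sum \<psi> {u\<in>{1..n}. k \<in> I u})\<bar> < 1"
      using disc_less_witness[of m n I 1] dm by (metis (no_types, lifting) mem_Collect_eq order_less_le_trans)
    from lt have "edge_sum \<psi> {u\<in>{1..n}. k \<in> I u} = 0" by linarith
    then have "even (\<Sum>u\<in>{u\<in>{1..n}. k \<in> I u}. \<psi> u)" unfolding edge_sum_def by simp
    moreover have "{u\<in>{u\<in>{1..n}. k \<in> I u}. odd (\<psi> u)} = {u\<in>{1..n}. k \<in> I u}"
      using PiE_mem[OF \<psi>] by fastforce
    ultimately show "even (card {u\<in>{1..n}. k \<in> I u})" by (simp add: even_sum_iff)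
  qed auto
  also have "\<dots> \<le> 1 / real (m choose d)" by (rule all_edges_even_prob[OF n dm(2)])
  also have "\<dots> \<le> 1 / (real m / real d) ^ d"
    using binomial_ge_n_over_k_pow_k[OF dm(2), where 'a=real] dm
    by (intro divide_left_mono mult_pos_pos) auto
  also have "\<dots> = (real d / real m) ^ d" by (simp add: power_divide)
  also have "\<dots> \<le> (1 - \<epsilon>) ^ d" by (intro power_mono \<epsilon>) auto
  finally show ?thesis .
qed

text \<open>The lower bound on \<open>l\<close> is what makes the variance bound hold for all \<open>k > l\<close> except with probability
\<open>(2 exp (- 2)) ^ n\<close> for each \<open>k\<close>: it leaves every vertex at least a large constant expected number of
incidences in \<open>{1..k}\<close>.\<close>

lemma disc_prob_anticoncentration:
  fixes \<epsilon> t :: real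
  assumes n: "n > 0" and dm: "0 < d" "d \<le> m"
    and \<epsilon>: "0 < \<epsilon>" "\<epsilon> \<le> 1" "real d / real m \<le> 1 - \<epsilon>"
    and l: "20 * real m / (\<epsilon> * real d) \<le> real l" and t: "t \<ge> 1"
  shows "measure_pmf.prob (edge_dependent_model n m d) {H. real_of_int (disc H) < t}
    \<le> real m * (2 * exp (- 2)) ^ n + 2 ^ n * (6 * t / sqrt (\<epsilon> * real d * real n / (32 * real m))) ^ (m - l)"
proof (rule disc_prob_union_bound)
  define W where "W = \<epsilon> * real d * real n / (32 * real m)"
  have m: "m > 0" using dm by simp
  have W: "W > 0" using n dm m \<epsilon> by (simp add: W_def)
  show "0 \<le> 6 * t / sqrt (\<epsilon> * real d * real n / (32 * real m))" using t \<epsilon> by simp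
  show "measure_pmf.prob (Pi_pmf {1..n} False (\<lambda>v. bernoulli_pmf (p v)))
        {f. \<bar>real_of_int (edge_sum \<psi> {v\<in>{1..n}. f v})\<bar> < t} \<le> 6 * t / sqrt (\<epsilon> * real d * real n / (32 * real m))"
    if "\<And>v. v \<in> {1..n} \<Longrightarrow> 0 \<le> p v \<and> p v \<le> 1" "\<And>v. v \<in> {1..n} \<Longrightarrow> \<psi> v \<in> {-1, 1}"
      "\<epsilon> * real d * real n / (32 * real m) \<le> (\<Sum>v\<in>{1..n}. p v * (1 - p v))" for p \<psi>
    using W by (intro bernoulli_signed_sum_interval_le that t) (auto simp: W_def)
  show "measure_pmf.prob (Pi_pmf {1..n} {} (\<lambda>_. pmf_of_set {S. S \<subseteq> {1..m} \<and> card S = d}))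
      {I. (\<Sum>v\<in>{1..n}. density_below k (I v) * (1 - density_below k (I v))) < \<epsilon> * real d * real n / (32 * real m)}
    \<le> (2 * exp (- 2)) ^ n" if k: "k \<in> {l<..m}" for k
  proof -
    have "20 * real m / (\<epsilon> * real d) \<le> real k" using l k by auto
    then have "4 + 1 \<le> \<epsilon> * real d * real k / (4 * real m)" using dm m \<epsilon> by (simp add: field_simps)
    from exposure_variance_small_prob[OF dm m _ _ \<epsilon> _ this] k show ?thesis by simp
  qed
qed (use dm in auto)

text \<open>Here it suffices to expose half of the edges, and for these the failure probability of the
variance bound is exponentially small in \<open>d n\<close>. This beats the number \<open>m\<close> of edges, which may be
exponentially large in \<open>n\<close> but is at most \<open>d n\<close> when \<open>d n / m \<ge> 1\<close>.\<close>

lemma disc_prob_spread: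
  fixes \<epsilon> L :: real
  assumes n: "n > 0" and dm: "0 < d" "d \<le> m"
    and \<epsilon>: "0 < \<epsilon>" "\<epsilon> \<le> 1" "real d / real m \<le> 1 - \<epsilon>" and \<epsilon>d: "64 \<le> \<epsilon> * real d"
    and L: "8 * ln 2 \<le> L" "4 * L \<le> \<epsilon> * real d * real n / (32 * real m)"
  shows "measure_pmf.prob (edge_dependent_model n m d)
      {H. real_of_int (disc H) < sqrt (L * (\<epsilon> * real d * real n / (32 * real m))) / 8}
    \<le> real m * exp (- (\<epsilon> / 32 * (real d * real n))) + 2 ^ n * exp (- (exp (- 4 * L) / 4 * (real m / 2)))"
proof -
  let ?W = "\<epsilon> * real d * real n / (32 * real m)" and ?q = "exp (- 4 * L) / 4"
  let ?l = "m div 2"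
  define K where "K = \<epsilon> * real d / 8 - 1"
  have m: "m > 0" using dm by simp
  have K: "0 \<le> K" using \<epsilon>d by (simp add: K_def)
  have L0: "0 \<le> L" using L(1) by (smt (verit) ln_gt_zero)
  have q: "0 \<le> ?q" "?q \<le> 1" using L0 by (auto intro: order_trans[of _ 1])
  have "measure_pmf.prob (edge_dependent_model n m d) {H. real_of_int (disc H) < sqrt (L * ?W) / 8}
      \<le> real m * (2 * exp (- K / 2)) ^ n + 2 ^ n * (1 - ?q) ^ (m - ?l)"
  proof (rule disc_prob_union_bound)
    show "measure_pmf.prob (Pi_pmf {1..n} False (\<lambda>v. bernoulli_pmf (p v)))
        {f. \<bar>real_of_int (edge_sum \<psi> {v\<in>{1..n}. f v})\<bar> < sqrt (L * ?W) / 8} \<le> 1 - ?q"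
      if "\<And>v. v \<in> {1..n} \<Longrightarrow> 0 \<le> p v \<and> p v \<le> 1" "\<And>v. v \<in> {1..n} \<Longrightarrow> \<psi> v \<in> {-1, 1}"
        "?W \<le> (\<Sum>v\<in>{1..n}. p v * (1 - p v))" for p \<psi>
      by (intro bernoulli_signed_sum_spread that L) auto
    show "measure_pmf.prob (Pi_pmf {1..n} {} (\<lambda>_. pmf_of_set {S. S \<subseteq> {1..m} \<and> card S = d}))
        {I. (\<Sum>v\<in>{1..n}. density_below k (I v) * (1 - density_below k (I v))) < ?W}
      \<le> (2 * exp (- K / 2)) ^ n" if k: "k \<in> {?l<..m}" for k
    proof -
      have "real m \<le> 2 * real k" using k by auto
      then have "\<epsilon> * real d * real m \<le> \<epsilon> * real d * (2 * real k)" using \<epsilon> by (intro mult_left_mono) auto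
      then have "K + 1 \<le> \<epsilon> * real d * real k / (4 * real m)" using m by (simp add: K_def field_simps)
      from exposure_variance_small_prob[OF dm m _ _ \<epsilon> K this] k show ?thesis by simp
    qed
  qed (use dm m q in auto)
  also have "(2 * exp (- K / 2)) ^ n \<le> exp (- (\<epsilon> / 32 * real d)) ^ n"
  proof (rule power_mono)
    have "2 * exp (- K / 2) \<le> exp 1 * exp (- K / 2)"
      using exp_ge_add_one_self[of 1] by (intro mult_right_mono) auto
    also have "\<dots> = exp (3 / 2 - \<epsilon> * real d / 16)"
    proof -
      have "1 + (- K / 2) = 3 / 2 - \<epsilon> * real d / 16" by (simp add: K_def field_simps)
      then show ?thesis by (simp only: exp_add[symmetric])
    qed
    also have "\<dots> \<le> exp (- (\<epsilon> / 32 * real d))" using \<epsilon>d by simp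
    finally show "2 * exp (- K / 2) \<le> exp (- (\<epsilon> / 32 * real d))" .
  qed simp
  also have "exp (- (\<epsilon> / 32 * real d)) ^ n = exp (- (\<epsilon> / 32 * (real d * real n)))"
    by (simp add: exp_of_nat_mult[symmetric] mult_ac)
  also have "(1 - ?q) ^ (m - ?l) \<le> exp (- ?q) ^ (m - ?l)"
    using exp_ge_add_one_self[of "- ?q"] q by (intro power_mono) auto
  also have "\<dots> = exp (- (?q * real (m - ?l)))" by (simp add: exp_of_nat_mult[symmetric] mult_ac)
  also have "\<dots> \<le> exp (- (?q * (real m / 2)))"
  proof -
    have "real m / 2 \<le> real (m - ?l)" by linarith
    then have "?q * (real m / 2) \<le> ?q * real (m - ?l)" using q by (intro mult_left_mono) auto
    then show ?thesis by simp
  qed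
  finally show ?thesis by (simp add: mult_left_mono add_mono)
qed

section \<open>The two regimes\<close>

text \<open>Write \<open>x = n / m\<close>. The value of \<open>\<kappa>\<close> gives the conditional probability \<open>\<beta> = 2 powr (- x) / 16\<close> per edge,
so that \<open>2 ^ n * \<beta> ^ (m - l) = 2 powr (x l) / 16 ^ (m - l)\<close>. It remains to see that giving away
\<open>l \<approx> 20 m / (\<epsilon> d)\<close> edges is affordable. Since the threshold is at least \<open>1\<close>, \<open>4 powr x \<le> d x\<close>, hence
\<open>x \<le> log 2 d\<close>, and so \<open>x l \<le> m\<close> for large \<open>d\<close>.\<close>

lemma disc_prob_dense:
  fixes \<epsilon> \<kappa> A :: real
  assumes n: "n > 0" and dm: "0 < d" "d \<le> m"
    and \<epsilon>: "0 < \<epsilon>" "\<epsilon> \<le> 1" "real d / real m \<le> 1 - \<epsilon>"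
    and large: "42 \<le> \<epsilon> * real d" "21 * log 2 (real d) \<le> \<epsilon> * real d"
  defines "\<kappa> \<equiv> sqrt (\<epsilon> / 32) / 96"
  defines "A \<equiv> 2 powr (- (real n / real m)) * sqrt (real d * real n / real m)"
  assumes t: "\<kappa> * A \<ge> 1"
  shows "measure_pmf.prob (edge_dependent_model n m d) {H. real_of_int (disc H) < \<kappa> * A}
    \<le> real m * (2 * exp (- 2)) ^ n + (1 / 2) ^ m"
proof -
  define x where "x = real n / real m"
  define l where "l = nat \<lceil>20 * real m / (\<epsilon> * real d)\<rceil>"
  have m: "m > 0" using dm by simp
  have x: "x > 0" "x * real m = real n" using n m by (auto simp: x_def)
  have \<kappa>: "0 < \<kappa>" "\<kappa> \<le> 1"
  proof -
    have "sqrt (\<epsilon> / 32) \<le> 1" using \<epsilon> by simp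
    then show "\<kappa> \<le> 1" unfolding \<kappa>_def by linarith
    show "0 < \<kappa>" using \<epsilon> by (simp add: \<kappa>_def)
  qed
  have l1: "20 * real m / (\<epsilon> * real d) \<le> real l" unfolding l_def by linarith
  have "\<epsilon> * real d \<le> 1 * real m" using \<epsilon> dm by (intro mult_mono) auto
  then have "1 \<le> real m / (\<epsilon> * real d)" using \<epsilon> dm by simp
  moreover have "real l \<le> 20 * real m / (\<epsilon> * real d) + 1"
  proof -
    have "0 \<le> 20 * real m / (\<epsilon> * real d)" using \<epsilon> by simp
    then show ?thesis unfolding l_def by linarith
  qed
  ultimately have l2: "real l \<le> 21 * real m / (\<epsilon> * real d)" by simp
  have "21 * real m / (\<epsilon> * real d) \<le> real m / 2"
  proof -
    have "42 * real m \<le> \<epsilon> * real d * real m" using large(1) by (intro mult_right_mono) auto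
    then show ?thesis using \<epsilon> dm by (simp add: field_simps)
  qed
  then have l3: "real l \<le> real m / 2" using l2 by linarith
  \<comment> \<open>From \<open>A \<ge> 1\<close> and \<open>x \<le> 2 powr x\<close>.\<close>
  have powx: "2 powr x \<le> real d"
  proof -
    have A: "1 \<le> A"
    proof -
      have "A \<ge> 0" by (simp add: A_def)
      then have "\<kappa> * A \<le> 1 * A" using \<kappa> by (intro mult_right_mono) auto
      then show ?thesis using t by simp
    qed
    then have "2 powr x \<le> sqrt (real d * x)"
      by (simp add: A_def x_def powr_minus field_simps)
    then have "(2 powr x)\<^sup>2 \<le> real d * x"
      using x by (metis real_sqrt_le_iff real_sqrt_abs abs_of_nonneg powr_ge_zero)
    also have "\<dots> \<le> real d * 2 powr x"
    proof (rule mult_left_mono)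
      have "x * ln 2 \<ge> x * (1/2)" using x ln2_ge_two_thirds by (intro mult_left_mono) auto
      then have "exp (x * (1/2)) \<le> exp (x * ln 2)" by simp
      moreover have "1 + x * (1/2) + (x * (1/2))\<^sup>2 / 2 \<le> exp (x * (1/2))"
        using x by (intro exp_lower_Taylor_quadratic) simp
      ultimately have "1 + x * (1/2) + (x * (1/2))\<^sup>2 / 2 \<le> exp (x * ln 2)" by linarith
      moreover have "0 \<le> (x / 2 - 1)\<^sup>2" by simp
      ultimately have "x \<le> exp (x * ln 2)" by (simp add: power2_eq_square field_simps)
      then show "x \<le> 2 powr x" by (simp add: powr_def)
    qed simp
    finally have "2 powr x * 2 powr x \<le> real d * 2 powr x" by (simp add: power2_eq_square)
    then show ?thesis by simp
  qed
  have "x \<le> log 2 (real d)" using powx dm by (simp add: le_log_iff)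
  have xl: "x * real l \<le> real m"
  proof -
    have "x * real l \<le> log 2 (real d) * (21 * real m / (\<epsilon> * real d))"
      using \<open>x \<le> log 2 (real d)\<close> l2 x by (intro mult_mono) auto
    also have "\<dots> = (21 * log 2 (real d)) * real m / (\<epsilon> * real d)" by simp
    also have "\<dots> \<le> (\<epsilon> * real d) * real m / (\<epsilon> * real d)"
      using large(2) \<epsilon> by (intro divide_right_mono mult_right_mono) auto
    also have "\<dots> = real m" using \<epsilon> dm by simp
    finally show ?thesis .
  qed
  have \<beta>: "6 * (\<kappa> * A) / sqrt (\<epsilon> * real d * real n / (32 * real m)) = 2 powr (- x) / 16"
  proof -
    have "\<epsilon> * real d * real n / (32 * real m) = (\<epsilon> / 32) * (real d * real n / real m)" by simp
    then have "sqrt (\<epsilon> * real d * real n / (32 * real m)) = sqrt (\<epsilon> / 32) * sqrt (real d * real n / real m)"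
      by (simp only: real_sqrt_mult)
    moreover have "sqrt (\<epsilon> / 32) > 0" "sqrt (real d * real n / real m) > 0" using \<epsilon> n dm m by auto
    moreover have "6 * (a / 96 * (u * b)) / (a * b) = u / 16" if "a > 0" "b > 0" for a b u :: real
      using that by simp
    ultimately show ?thesis unfolding \<kappa>_def A_def x_def by (simp only:)
  qed
  have lm: "l \<le> m" using l3 by linarith
  have "measure_pmf.prob (edge_dependent_model n m d) {H. real_of_int (disc H) < \<kappa> * A}
      \<le> real m * (2 * exp (- 2)) ^ n + 2 ^ n * (2 powr (- x) / 16) ^ (m - l)"
    using disc_prob_anticoncentration[OF n dm \<epsilon> l1 t] unfolding \<beta> .
  also have "2 ^ n * (2 powr (- x) / 16) ^ (m - l) \<le> (1 / 2) ^ m"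
  proof -
    have "2 ^ n * (2 powr (- x) / 16) ^ (m - l) = 2 powr (real n) * (2 powr (- x - 4)) powr (real (m - l))"
      by (simp add: powr_realpow powr_diff)
    also have "\<dots> = 2 powr (real n + (- x - 4) * real (m - l))"
      by (simp add: powr_powr powr_add)
    finally have eq: "2 ^ n * (2 powr (- x) / 16) ^ (m - l) = 2 powr (real n + (- x - 4) * real (m - l))" .
    have "real n + (- x - 4) * real (m - l) = x * real l - 4 * (real m - real l)"
      using lm x(2) by (simp add: of_nat_diff algebra_simps)
    also have "\<dots> \<le> - real m" using xl l3 by argo
    finally have "2 powr (real n + (- x - 4) * real (m - l)) \<le> (2::real) powr (- real m)" by simp
    also have "\<dots> = (1 / 2) ^ m"
      by (simp add: powr_minus powr_realpow power_one_over inverse_eq_divide)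
    finally show ?thesis unfolding eq .
  qed
  finally show ?thesis by simp
qed

text \<open>With \<open>L = ln \<gamma> / 8\<close> an edge exceeds the threshold with conditional probability at least
\<open>1 / (4 sqrt \<gamma>) \<ge> sqrt (n / m) / 4\<close>. Over \<open>m / 2\<close> edges, all of them stay below it with probability at
most \<open>exp (- n sqrt (m / n) / 8) \<le> exp (- 2 n)\<close>, which beats the \<open>2 ^ n\<close> colourings. That \<open>\<gamma>\<close> is also
at most \<open>d n / m\<close> keeps \<open>L\<close> below the variance, the range in which the large-deviation bound holds.\<close>

lemma disc_prob_sparse:
  fixes \<epsilon> :: real
  assumes n: "n > 0" and dm: "0 < d" "d \<le> m"
    and \<epsilon>: "0 < \<epsilon>" "\<epsilon> \<le> 1" "real d / real m \<le> 1 - \<epsilon>" and \<epsilon>d: "64 \<le> \<epsilon> * real d"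
  defines "\<gamma> \<equiv> min (real m / real n) (real d * real n / real m)"
  assumes \<gamma>: "2 ^ 64 \<le> \<gamma>" and ln\<gamma>: "16 * ln \<gamma> \<le> \<epsilon> * (real d * real n / real m)"
  shows "measure_pmf.prob (edge_dependent_model n m d)
      {H. real_of_int (disc H) < sqrt (\<epsilon> / 256) / 8 * sqrt (real d * real n / real m * ln \<gamma>)}
    \<le> real d * real n * exp (- (\<epsilon> / 32 * (real d * real n))) + (2 * exp (- 2)) ^ n"
proof -
  define L where "L = ln \<gamma> / 8"
  have m: "m > 0" using dm by simp
  have \<gamma>0: "\<gamma> > 0" using \<gamma> by (rule less_le_trans[rotated]) simp
  have "64 * ln 2 \<le> ln \<gamma>"
  proof -
    have "64 * ln 2 = ln (2 ^ 64 :: real)" by (subst ln_realpow) simp_all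
    also have "\<dots> \<le> ln \<gamma>" using \<gamma> \<gamma>0 by (subst ln_le_cancel_iff) simp_all
    finally show ?thesis .
  qed
  then have L: "8 * ln 2 \<le> L" "4 * L \<le> \<epsilon> * real d * real n / (32 * real m)"
    using ln\<gamma> by (auto simp: L_def)
  have "L * (\<epsilon> * real d * real n / (32 * real m)) = \<epsilon> / 256 * (real d * real n / real m * ln \<gamma>)"
    by (simp add: L_def)
  then have t: "sqrt (L * (\<epsilon> * real d * real n / (32 * real m))) / 8
      = sqrt (\<epsilon> / 256) / 8 * sqrt (real d * real n / real m * ln \<gamma>)"
    by (simp only: real_sqrt_mult)
  have "measure_pmf.prob (edge_dependent_model n m d)
      {H. real_of_int (disc H) < sqrt (\<epsilon> / 256) / 8 * sqrt (real d * real n / real m * ln \<gamma>)}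
    \<le> real m * exp (- (\<epsilon> / 32 * (real d * real n))) + 2 ^ n * exp (- (exp (- 4 * L) / 4 * (real m / 2)))"
    using disc_prob_spread[OF n dm \<epsilon> \<epsilon>d L] unfolding t .
  also have "\<dots> \<le> real d * real n * exp (- (\<epsilon> / 32 * (real d * real n))) + 2 ^ n * exp (- 2 * real n)"
  proof (intro add_mono mult_right_mono mult_left_mono)
    have parts: "2 ^ 64 \<le> real m / real n" "2 ^ 64 \<le> real d * real n / real m"
      using \<gamma> unfolding \<gamma>_def min.bounded_iff by blast+
    have "1 \<le> real d * real n / real m" by (rule order_trans[OF _ parts(2)]) simp
    then show "real m \<le> real d * real n" using m by simp
    define y where "y = sqrt (real m / real n)"
    have ym: "real m = real n * y\<^sup>2" using n by (simp add: y_def)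
    have y: "16 \<le> y" unfolding y_def by (intro real_le_rsqrt order_trans[OF _ parts(1)]) simp
    have "exp (- 4 * L) = 1 / sqrt \<gamma>"
      using \<gamma>0 by (simp add: L_def exp_minus ln_sqrt[symmetric] inverse_eq_divide)
    moreover have "1 / y \<le> 1 / sqrt \<gamma>"
      unfolding y_def \<gamma>_def using \<gamma>0 n m unfolding \<gamma>_def by (intro divide_left_mono) auto
    ultimately have "1 / y / 4 * (real m / 2) \<le> exp (- 4 * L) / 4 * (real m / 2)"
      by (intro mult_right_mono) auto
    moreover have "1 / y / 4 * (real m / 2) = real n * y / 8"
      using y by (simp add: ym power2_eq_square)
    moreover have "real n * 16 / 8 \<le> real n * y / 8" using y by (intro divide_right_mono mult_left_mono) auto
    ultimately show "exp (- (exp (- 4 * L) / 4 * (real m / 2))) \<le> exp (- 2 * real n)" by simp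
  qed auto
  also have "2 ^ n * exp (- 2 * real n) = (2 * exp (- 2)) ^ n"
    by (simp add: power_mult_distrib exp_of_nat_mult[symmetric] mult_ac)
  finally show ?thesis .
qed

lemma whpI:
  assumes g: "g \<longlonglongrightarrow> 0"
    and le: "\<forall>\<^sub>F n in sequentially. measure_pmf.prob (M n) {x. \<not> P n x} \<le> g n"
  shows "whp M P"
  unfolding whp_def
proof (rule tendsto_sandwich[OF _ _ _ tendsto_const])
  show "(\<lambda>n. 1 - g n) \<longlonglongrightarrow> 1" using tendsto_diff[OF tendsto_const g, of 1] by simp
  show "\<forall>\<^sub>F n in sequentially. 1 - g n \<le> measure_pmf.prob (M n) {x. P n x}"
    using le
  proof eventually_elim
    case (elim n)
    have "measure_pmf.prob (M n) {x. P n x} = 1 - measure_pmf.prob (M n) {x. \<not> P n x}"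
      by (subst measure_pmf.prob_compl[symmetric]) (auto intro!: arg_cong[of _ _ "measure_pmf.prob (M n)"])
    then show ?case using elim by linarith
  qed
qed auto

theorem theorem1p2:
  fixes m d :: "nat \<Rightarrow> nat"
  assumes pos: "\<And>n. n \<ge> 1 \<Longrightarrow> 0 < m n \<and> 0 < d n"
    and le: "\<And>n. n \<ge> 1 \<Longrightarrow> d n \<le> m n"
    and degree: "filterlim (\<lambda>n. real (d n) * real n / real (m n)) at_top sequentially"
    and d_inf: "filterlim (\<lambda>n. real (d n)) at_top sequentially"
    and bounded_away: "\<exists>\<epsilon>\<^sub>0>0. \<forall>\<^sub>F n in sequentially. real (d n) / real (m n) \<le> 1 - \<epsilon>\<^sub>0"
  shows
    "((\<lambda>n. real (m n)) \<in> O(\<lambda>n. real n) \<longrightarrow>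
        (\<exists>\<kappa>::real. \<kappa> > 0 \<and>
          whp (\<lambda>n. edge_dependent_model n (m n) (d n))
            (\<lambda>n H. real_of_int (disc H) \<ge>
               \<kappa> * max (2 powr (- (real n / real (m n))) * sqrt (real (d n) * real n / real (m n))) 1)))
     \<and>
     ((\<lambda>n. real n / real (m n)) \<longlonglongrightarrow> 0 \<longrightarrow>
        (\<exists>\<kappa>::real. \<kappa> > 0 \<and>
          whp (\<lambda>n. edge_dependent_model n (m n) (d n))
            (\<lambda>n H. let \<gamma> = min (real (m n) / real n) (real (d n) * real n / real (m n)) in
               real_of_int (disc H) \<ge> \<kappa> * sqrt (real (d n) * real n / real (m n) * ln \<gamma>))))"
proof (intro conjI impI)
  from bounded_away obtain \<epsilon>\<^sub>0 :: real where \<epsilon>\<^sub>0: "\<epsilon>\<^sub>0 > 0"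
    "\<forall>\<^sub>F n in sequentially. real (d n) / real (m n) \<le> 1 - \<epsilon>\<^sub>0" by blast
  define \<epsilon> where "\<epsilon> = min \<epsilon>\<^sub>0 1"
  have \<epsilon>: "0 < \<epsilon>" "\<epsilon> \<le> 1" using \<epsilon>\<^sub>0 by (auto simp: \<epsilon>_def)
  have ratio: "\<forall>\<^sub>F n in sequentially. real (d n) / real (m n) \<le> 1 - \<epsilon>"
    using \<epsilon>\<^sub>0(2) by eventually_elim (simp add: \<epsilon>_def)
  have d_nat: "filterlim d at_top sequentially"
    unfolding filterlim_at_top
  proof
    fix Z show "\<forall>\<^sub>F n in sequentially. Z \<le> d n"
      using d_inf[unfolded filterlim_at_top, rule_format, of "real Z"] by eventually_elim simp
  qed
  have m_nat: "filterlim m at_top sequentially"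
    by (rule filterlim_at_top_mono[OF d_nat]) (use le in \<open>auto simp: eventually_sequentially\<close>)
  have geo: "(2::real) * exp (- 2) < 1"
    using exp_ge_add_one_self[of "2::real"] by (simp add: exp_minus field_simps)
  have large: "\<forall>\<^sub>F n in sequentially. c \<le> \<epsilon> * real (d n)" for c
    using d_inf[unfolded filterlim_at_top, rule_format, of "c / \<epsilon>"]
    by eventually_elim (use \<epsilon> in \<open>simp add: field_simps\<close>)
  have ln_small: "\<forall>\<^sub>F y in at_top. ln y \<le> c * y" if "c > 0" for c :: real
    using order_tendstoD(2)[OF ln_x_over_x_tendsto_0 that] eventually_gt_at_top[of 0]
    by eventually_elim (simp add: field_simps)
  show "\<exists>\<kappa>::real. \<kappa> > 0 \<and> whp (\<lambda>n. edge_dependent_model n (m n) (d n))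
            (\<lambda>n H. real_of_int (disc H) \<ge>
               \<kappa> * max (2 powr (- (real n / real (m n))) * sqrt (real (d n) * real n / real (m n))) 1)"
    if O: "(\<lambda>n. real (m n)) \<in> O(\<lambda>n. real n)"
  proof (intro exI conjI)
    define \<kappa> where "\<kappa> = sqrt (\<epsilon> / 32) / 96"
    define A where "A = (\<lambda>n. 2 powr (- (real n / real (m n))) * sqrt (real (d n) * real n / real (m n)))"
    show \<kappa>0: "\<kappa> > 0" using \<epsilon> by (simp add: \<kappa>_def)
    have "sqrt (\<epsilon> / 32) \<le> 1" using \<epsilon> by simp
    then have \<kappa>1: "\<kappa> \<le> 1" unfolding \<kappa>_def by linarith
    from O obtain C where C: "\<forall>\<^sub>F n in sequentially. real (m n) \<le> C * real n"
      by (auto elim!: landau_o.bigE)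
    define g where "g = (\<lambda>n. C * (real n * (2 * exp (- 2)) ^ n) + (1 / 2) ^ m n + (1 - \<epsilon>) ^ d n)"
    have log_small: "\<forall>\<^sub>F n in sequentially. 21 * log 2 (real (d n)) \<le> \<epsilon> * real (d n)"
    proof -
      have "\<forall>\<^sub>F n in sequentially. ln (real (d n)) \<le> (\<epsilon> * ln 2 / 21) * real (d n)"
        using \<epsilon> by (intro eventually_compose_filterlim[OF ln_small d_inf]) simp
      then show ?thesis by eventually_elim (simp add: log_def field_simps)
    qed
    show "whp (\<lambda>n. edge_dependent_model n (m n) (d n))
            (\<lambda>n H. real_of_int (disc H) \<ge>
               \<kappa> * max (2 powr (- (real n / real (m n))) * sqrt (real (d n) * real n / real (m n))) 1)"
    proof (rule whpI[where g=g])
      have l1: "(\<lambda>n. C * (real n * (2 * exp (- 2)) ^ n)) \<longlonglongrightarrow> C * 0"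
        using geo by (intro tendsto_mult tendsto_const powser_times_n_limit_0) simp
      have l2: "(\<lambda>n. (1 / 2 :: real) ^ m n) \<longlonglongrightarrow> 0"
        by (rule filterlim_compose[OF LIMSEQ_realpow_zero m_nat]) auto
      have l3: "(\<lambda>n. (1 - \<epsilon>) ^ d n) \<longlonglongrightarrow> 0"
        by (rule filterlim_compose[OF LIMSEQ_realpow_zero d_nat]) (use \<epsilon> in auto)
      from tendsto_add[OF tendsto_add[OF l1 l2] l3]
      show "g \<longlonglongrightarrow> 0" unfolding g_def by simp
      show "\<forall>\<^sub>F n in sequentially. measure_pmf.prob (edge_dependent_model n (m n) (d n))
          {H. \<not> \<kappa> * max (2 powr (- (real n / real (m n))) * sqrt (real (d n) * real n / real (m n))) 1
            \<le> real_of_int (disc H)} \<le> g n"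
        using C ratio large[of 42] log_small eventually_ge_at_top[of 1]
      proof eventually_elim
        case (elim n)
        have n: "n > 0" and dm: "0 < d n" "d n \<le> m n" using elim pos[of n] le[of n] by auto
        have summands: "0 \<le> C * (real n * (2 * exp (- 2)) ^ n)" "0 \<le> (1 - \<epsilon>) ^ d n"
          using \<epsilon> order_trans[OF of_nat_0_le_iff elim(1)] by (auto simp: mult.assoc[symmetric])
        \<comment> \<open>Below \<open>1\<close> the threshold is covered by parity, above it by the union bound.\<close>
        show ?case
        proof (cases "\<kappa> * A n \<ge> 1")
          case True
          have "\<kappa> * A n \<le> 1 * A n" using \<kappa>1 by (intro mult_right_mono) (auto simp: A_def)
          then have "max (A n) 1 = A n" using True by simp
          then have "measure_pmf.prob (edge_dependent_model n (m n) (d n)) {H. \<not> \<kappa> * max (A n) 1 \<le> real_of_int (disc H)}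
              \<le> real (m n) * (2 * exp (- 2)) ^ n + (1 / 2) ^ m n"
            using disc_prob_dense[OF n dm \<epsilon> elim(2-4)] True by (simp add: not_le \<kappa>_def A_def)
          also have "real (m n) * (2 * exp (- 2)) ^ n \<le> C * real n * (2 * exp (- 2)) ^ n"
            using elim(1) by (intro mult_right_mono) auto
          finally show ?thesis using summands by (simp add: g_def A_def mult.assoc)
        next
          case False
          then have "\<kappa> * max (A n) 1 \<le> 1" using \<kappa>1 by (simp add: max_def)
          then have "measure_pmf.prob (edge_dependent_model n (m n) (d n)) {H. \<not> \<kappa> * max (A n) 1 \<le> real_of_int (disc H)}
              \<le> measure_pmf.prob (edge_dependent_model n (m n) (d n)) {H. real_of_int (disc H) < 1}"
            by (intro measure_pmf.finite_measure_mono) auto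
          also have "\<dots> \<le> (1 - \<epsilon>) ^ d n" by (rule disc_less_one_prob[OF n dm elim(2)])
          also have "\<dots> \<le> g n" using summands by (simp add: g_def)
          finally show ?thesis by (simp add: A_def)
        qed
      qed
    qed
  qed
  show "\<exists>\<kappa>::real. \<kappa> > 0 \<and> whp (\<lambda>n. edge_dependent_model n (m n) (d n))
            (\<lambda>n H. let \<gamma> = min (real (m n) / real n) (real (d n) * real n / real (m n)) in
               real_of_int (disc H) \<ge> \<kappa> * sqrt (real (d n) * real n / real (m n) * ln \<gamma>))"
    if sparse: "(\<lambda>n. real n / real (m n)) \<longlonglongrightarrow> 0"
  proof (intro exI conjI)
    define \<kappa> where "\<kappa> = sqrt (\<epsilon> / 256) / 8"
    show "\<kappa> > 0" using \<epsilon> by (simp add: \<kappa>_def)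
    define h where "h = (\<lambda>y. y * exp (- (\<epsilon> / 32 * y)))"
    define g where "g = (\<lambda>n. h (real (d n) * real n) + (2 * exp (- 2)) ^ n)"
    have sparse_large: "\<forall>\<^sub>F n in sequentially. 2 ^ 64 \<le> real (m n) / real n"
    proof -
      have "\<forall>\<^sub>F n in sequentially. real n / real (m n) < 1 / 2 ^ 64"
        by (rule order_tendstoD(2)[OF sparse]) simp
      then show ?thesis using eventually_ge_at_top[of 1]
      proof eventually_elim
        case (elim n)
        have "m n > 0" "n > 0" using pos[OF elim(2)] elim by auto
        then show ?case using elim(1) by (simp add: field_simps)
      qed
    qed
    have degree_large: "\<forall>\<^sub>F n in sequentially. 2 ^ 64 \<le> real (d n) * real n / real (m n)"
      using degree by (simp add: filterlim_at_top)
    have degree_ln: "\<forall>\<^sub>F n in sequentially. ln (real (d n) * real n / real (m n)) \<le> \<epsilon> / 16 * (real (d n) * real n / real (m n))"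
      using \<epsilon> by (intro eventually_compose_filterlim[OF ln_small degree]) simp
    have dn: "filterlim (\<lambda>n. real (d n) * real n) at_top sequentially"
      by (rule filterlim_at_top_mult_at_top[OF d_inf filterlim_real_sequentially])
    show "whp (\<lambda>n. edge_dependent_model n (m n) (d n))
            (\<lambda>n H. let \<gamma> = min (real (m n) / real n) (real (d n) * real n / real (m n)) in
               real_of_int (disc H) \<ge> \<kappa> * sqrt (real (d n) * real n / real (m n) * ln \<gamma>))"
    proof (rule whpI[where g=g])
      have "filterlim (\<lambda>y. \<epsilon> / 32 * y) at_top at_top"
        using \<epsilon> by (intro filterlim_tendsto_pos_mult_at_top[OF tendsto_const _ filterlim_ident]) simp
      from filterlim_compose[OF tendsto_power_div_exp_0[of 1] this]
      have "((\<lambda>y. 32 / \<epsilon> * ((\<epsilon> / 32 * y) ^ 1 / exp (\<epsilon> / 32 * y))) \<longlongrightarrow> 32 / \<epsilon> * 0) at_top"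
        by (intro tendsto_mult tendsto_const)
      moreover have "(\<lambda>y. 32 / \<epsilon> * ((\<epsilon> / 32 * y) ^ 1 / exp (\<epsilon> / 32 * y))) = h"
        using \<epsilon> by (auto simp: h_def exp_minus field_simps)
      ultimately have "(h \<longlongrightarrow> 0) at_top" by simp
      from tendsto_add[OF filterlim_compose[OF this dn] LIMSEQ_realpow_zero[of "2 * exp (- 2)"]] geo
      show "g \<longlonglongrightarrow> 0" unfolding g_def by simp
      show "\<forall>\<^sub>F n in sequentially. measure_pmf.prob (edge_dependent_model n (m n) (d n))
          {H. \<not> (let \<gamma> = min (real (m n) / real n) (real (d n) * real n / real (m n)) in
               real_of_int (disc H) \<ge> \<kappa> * sqrt (real (d n) * real n / real (m n) * ln \<gamma>))} \<le> g n"
        using ratio large[of 64] sparse_large degree_large degree_ln eventually_ge_at_top[of 1]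
      proof eventually_elim
        case (elim n)
        have n: "n > 0" and dm: "0 < d n" "d n \<le> m n" using elim pos[of n] le[of n] by auto
        let ?\<gamma> = "min (real (m n) / real n) (real (d n) * real n / real (m n))"
        have \<gamma>: "2 ^ 64 \<le> ?\<gamma>" using elim by simp
        have "0 < ?\<gamma>" by (rule less_le_trans[OF _ \<gamma>]) simp
        then have "ln ?\<gamma> \<le> ln (real (d n) * real n / real (m n))" by (intro ln_mono) auto
        then have "16 * ln ?\<gamma> \<le> \<epsilon> * (real (d n) * real n / real (m n))" using elim(5) by linarith
        from disc_prob_sparse[OF n dm \<epsilon> elim(1,2) \<gamma> this]
        show ?case by (simp add: Let_def not_le g_def h_def \<kappa>_def)
      qed
    qed
  qed
qed

end
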